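(* Let $\beta,\eta>0$. The flow map data-solution $\phi\mapsto u(t)$ for the Chen-Lee equation $$u_t+uu_x+\beta\mathcal{H}u_{xx}+\eta(\mathcal{H}u_x-u_{xx})=0,\quad t>0,\ x\in\mathbb{T},\qquad u(x,0)=\phi(x),$$ is not $C^2$ from $H^s(\mathbb{T})$ to $H^s(\mathbb{T})$, if $s<-1$.
   Context: $\mathbb{T}$ is the circle; functions and distributions are $2\pi$-periodic (complex-valued allowed). Fourier coefficients: $\widehat f(k)=\frac1{2\pi}\int_{-\pi}^{\pi}e^{-ikz}f(z)\,dz$, $k\in\mathbb{Z}$ (extended to periodic distributions). $H^s(\mathbb{T})$ has norm $\|\phi\|_{H^s}=(2\pi)^{1/2}\|(1+k^2)^{s/2}\widehat\phi(k)\|_{l^2(\mathbb{Z})}$. $\mathcal{H}$ is the Hilbert transform with Fourier multiplier $i\,\mathrm{sgn}(k)$. The flow map sends $\phi\in H^s(\mathbb{T})$ to the solution $u(t)$, $t\in[0,T]$ (for some $T>0$, assuming unique local solutions exist on $[0,T]$), of the integral equation $u(t)=S(t)\phi-\int_0^tS(t-t')[u(t')u_x(t')]\,dt'$, where $uu_x=\frac12\partial_x(u^2)$ and, for $t\ge0$, $\widehat{S(t)f}(k)=e^{i q(k)t-p(k)t}\widehat f(k)$ with $q(k)=\beta k|k|$, $p(k)=\eta(k^2-|k|)$, $k\in\mathbb{Z}$. The assertion is that there is no $T>0$ for which such a flow map exists and is of class $C^2$ from $H^s(\mathbb{T})$ to $H^s(\mathbb{T})$. *)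

theory Defs
  imports "HOL-Analysis.Analysis"
begin

section \<open>Periodic distributions\<close>

abbreviation vderiv :: "(real \<Rightarrow> complex) \<Rightarrow> real \<Rightarrow> complex" where
  "vderiv \<psi> \<equiv> (\<lambda>x. vector_derivative \<psi> (at x))"

definition test_functions :: "(real \<Rightarrow> complex) set" where
  "test_functions =
     {\<psi>. (\<forall>x. \<psi> (x + 2 * pi) = \<psi> x) \<and> (\<forall>n x. (vderiv ^^ n) \<psi> differentiable (at x))}"

definition Ck_norm :: "nat \<Rightarrow> (real \<Rightarrow> complex) \<Rightarrow> real" where
  "Ck_norm N \<psi> = (\<Sum>n\<le>N. SUP x. norm ((vderiv ^^ n) \<psi> x))"

text \<open>Continuity for the Frechet topology of \<^term>\<open>test_functions\<close> is boundedness by one of the norms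
  \<^term>\<open>Ck_norm N\<close>. Functionals are set to 0 outside \<^term>\<open>test_functions\<close>, so that equality of
  functionals is equality of distributions.\<close>

definition is_distribution :: "((real \<Rightarrow> complex) \<Rightarrow> complex) \<Rightarrow> bool" where
  "is_distribution f \<longleftrightarrow>
     (\<forall>\<psi>. \<psi> \<notin> test_functions \<longrightarrow> f \<psi> = 0) \<and>
     (\<forall>\<psi>\<in>test_functions. \<forall>\<theta>\<in>test_functions. f (\<lambda>x. \<psi> x + \<theta> x) = f \<psi> + f \<theta>) \<and>
     (\<forall>\<psi>\<in>test_functions. \<forall>a. f (\<lambda>x. a * \<psi> x) = a * f \<psi>) \<and>
     (\<exists>C N. \<forall>\<psi>\<in>test_functions. norm (f \<psi>) \<le> C * Ck_norm N \<psi>)"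

lemma vderiv_pow_Suc: "(vderiv ^^ n) (vderiv \<psi>) = (vderiv ^^ Suc n) \<psi>"
  by (simp only: funpow_Suc_right o_apply)

lemma test_functions_periodic_deriv:
  assumes "\<psi> \<in> test_functions"
  shows "(vderiv ^^ n) \<psi> (x + 2 * pi) = (vderiv ^^ n) \<psi> x"
proof (induction n arbitrary: x)
  case 0
  then show ?case using assms by (simp add: test_functions_def)
next
  case (Suc n)
  let ?g = "(vderiv ^^ n) \<psi>"
  have d: "(?g has_vector_derivative vector_derivative ?g (at y)) (at y)" for y
    using assms by (simp add: test_functions_def vector_derivative_works)
  have "((?g \<circ> (\<lambda>y. y + 2 * pi)) has_vector_derivative
           1 *\<^sub>R vector_derivative ?g (at (x + 2 * pi))) (at x)"
    by (rule vector_diff_chain_at) (auto intro!: derivative_eq_intros d)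
  moreover have "?g \<circ> (\<lambda>y. y + 2 * pi) = ?g" using Suc by auto
  ultimately have "(?g has_vector_derivative vector_derivative ?g (at (x + 2 * pi))) (at x)"
    by simp
  then show ?case by (simp add: vector_derivative_at)
qed

lemma test_functions_vderiv:
  assumes "\<psi> \<in> test_functions"
  shows "vderiv \<psi> \<in> test_functions"
proof -
  have "\<forall>n x. (vderiv ^^ n) (vderiv \<psi>) differentiable (at x)"
    unfolding vderiv_pow_Suc using assms unfolding test_functions_def by blast
  moreover have "\<forall>x. vderiv \<psi> (x + 2 * pi) = vderiv \<psi> x"
    using test_functions_periodic_deriv[OF assms, of 1] by simp
  ultimately show ?thesis by (simp add: test_functions_def)
qed

lemma vderiv_pow_add:
  assumes "\<psi> \<in> test_functions" "\<theta> \<in> test_functions"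
  shows "(vderiv ^^ n) (\<lambda>x. \<psi> x + \<theta> x) = (\<lambda>x. (vderiv ^^ n) \<psi> x + (vderiv ^^ n) \<theta> x)"
proof (induction n)
  case (Suc n)
  show ?case using assms
    by (auto simp: Suc test_functions_def fun_eq_iff vector_derivative_works
        intro!: vector_derivative_at has_vector_derivative_add)
qed simp

lemma vderiv_pow_mult:
  assumes "\<psi> \<in> test_functions"
  shows "(vderiv ^^ n) (\<lambda>x. a * \<psi> x) = (\<lambda>x. a * (vderiv ^^ n) \<psi> x)"
proof (induction n)
  case (Suc n)
  show ?case using assms
    by (auto simp: Suc test_functions_def fun_eq_iff vector_derivative_works
        intro!: vector_derivative_at has_vector_derivative_mult_right)
qed simp

lemma test_functions_add:
  assumes "\<psi> \<in> test_functions" "\<theta> \<in> test_functions"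
  shows "(\<lambda>x. \<psi> x + \<theta> x) \<in> test_functions"
  using assms vderiv_pow_add[OF assms] by (auto simp: test_functions_def)

lemma test_functions_mult:
  assumes "\<psi> \<in> test_functions"
  shows "(\<lambda>x. a * \<psi> x) \<in> test_functions"
  using assms vderiv_pow_mult[OF assms] by (auto simp: test_functions_def)

lemma vderiv_bounded:
  assumes "\<psi> \<in> test_functions"
  shows "bdd_above (range (\<lambda>x. norm ((vderiv ^^ n) \<psi> x)))"
proof -
  let ?g = "(vderiv ^^ n) \<psi>"
  have "continuous_on {0..2*pi} ?g"
    using assms by (auto simp: test_functions_def intro!: differentiable_imp_continuous_on
        differentiable_at_imp_differentiable_on)
  then have "bounded (?g ` {0..2*pi})"
    by (intro compact_imp_bounded compact_continuous_image) auto
  then obtain B where B: "\<And>x. x \<in> {0..2*pi} \<Longrightarrow> norm (?g x) \<le> B"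
    unfolding bounded_iff by blast
  have per_nat: "?g (x + 2 * pi * real m) = ?g x" for x m
  proof (induction m)
    case (Suc m)
    have "x + 2 * pi * real (Suc m) = (x + 2 * pi * real m) + 2 * pi" by (simp add: algebra_simps)
    then show ?case using Suc test_functions_periodic_deriv[OF assms, of n] by metis
  qed simp
  have per: "?g (x + 2 * pi * real_of_int m) = ?g x" for x m
  proof (cases "m \<ge> 0")
    case True
    then show ?thesis using per_nat[of x "nat m"] by simp
  next
    case False
    then show ?thesis using per_nat[of "x + 2 * pi * real_of_int m" "nat (-m)"] by simp
  qed
  have "norm (?g x) \<le> B" for x
  proof -
    define m where "m = \<lfloor>x / (2*pi)\<rfloor>"
    have "of_int m \<le> x / (2*pi)" "x / (2*pi) < of_int m + 1" unfolding m_def by linarith+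
    then have "of_int m * (2*pi) \<le> x" "x < (of_int m + 1) * (2*pi)"
      by (simp_all add: pos_le_divide_eq pos_divide_less_eq)
    then have "x + 2 * pi * real_of_int (-m) \<in> {0..2*pi}"
      by (auto simp: algebra_simps)
    with B show ?thesis using per[of x "-m"] by metis
  qed
  then show ?thesis by (auto simp: bdd_above_def)
qed

lemma Ck_norm_ge:
  assumes "\<psi> \<in> test_functions" "n \<le> N"
  shows "norm ((vderiv ^^ n) \<psi> x) \<le> Ck_norm N \<psi>"
proof -
  let ?s = "\<lambda>n. SUP x. norm ((vderiv ^^ n) \<psi> x)"
  have b: "norm ((vderiv ^^ n) \<psi> y) \<le> ?s n" for n y
    by (rule cSUP_upper) (auto intro: vderiv_bounded[OF assms(1)])
  have "?s n \<ge> 0" for n using b[of n 0] norm_ge_zero by (rule order_trans[rotated])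
  then have "?s n \<le> Ck_norm N \<psi>"
    unfolding Ck_norm_def using assms(2) by (intro member_le_sum) auto
  with b show ?thesis by (rule order_trans)
qed

lemma Ck_norm_nonneg: "\<psi> \<in> test_functions \<Longrightarrow> 0 \<le> Ck_norm N \<psi>"
  using Ck_norm_ge[of \<psi> 0 N 0] norm_ge_zero order_trans by blast

lemma Ck_norm_mono:
  assumes "\<psi> \<in> test_functions" "M \<le> N"
  shows "Ck_norm M \<psi> \<le> Ck_norm N \<psi>"
proof -
  have "0 \<le> (SUP x. norm ((vderiv ^^ n) \<psi> x))" for n
    by (rule order_trans[OF norm_ge_zero cSUP_upper[OF UNIV_I vderiv_bounded[OF assms(1)]]])
  then show ?thesis unfolding Ck_norm_def using assms(2) by (intro sum_mono2) auto
qed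

lemma Ck_norm_vderiv:
  assumes "\<psi> \<in> test_functions"
  shows "Ck_norm N (vderiv \<psi>) \<le> Ck_norm (Suc N) \<psi>"
proof -
  have nn: "0 \<le> (SUP x. norm ((vderiv ^^ n) \<psi> x))" for n
    by (rule order_trans[OF norm_ge_zero cSUP_upper[OF UNIV_I vderiv_bounded[OF assms]]])
  show ?thesis unfolding Ck_norm_def vderiv_pow_Suc
    using sum.atMost_Suc_shift[of "\<lambda>n. SUP x. norm ((vderiv ^^ n) \<psi> x)" N] nn[of 0] by linarith
qed

typedef pdist = "{f. is_distribution f}"
  morphisms pairing Abs_pdist
  by (rule exI[of _ "\<lambda>_. 0"]) (auto simp: is_distribution_def intro!: exI[of _ 0])

setup_lifting type_definition_pdist

lemma is_distribution_lincomb: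
  assumes "is_distribution f" "is_distribution g"
  shows "is_distribution (\<lambda>\<psi>. a * f \<psi> + b * g \<psi>)"
proof -
  obtain C N where 1: "\<And>\<psi>. \<psi> \<in> test_functions \<Longrightarrow> norm (f \<psi>) \<le> C * Ck_norm N \<psi>"
    using assms(1) unfolding is_distribution_def by blast
  obtain C' N' where 2: "\<And>\<psi>. \<psi> \<in> test_functions \<Longrightarrow> norm (g \<psi>) \<le> C' * Ck_norm N' \<psi>"
    using assms(2) unfolding is_distribution_def by blast
  have "norm (a * f \<psi> + b * g \<psi>) \<le> (norm a * \<bar>C\<bar> + norm b * \<bar>C'\<bar>) * Ck_norm (max N N') \<psi>"
    if "\<psi> \<in> test_functions" for \<psi>
  proof -
    have "norm (f \<psi>) \<le> \<bar>C\<bar> * Ck_norm (max N N') \<psi>"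
      by (rule order_trans[OF 1[OF that]], rule mult_mono)
         (auto simp: that Ck_norm_mono Ck_norm_nonneg)
    moreover have "norm (g \<psi>) \<le> \<bar>C'\<bar> * Ck_norm (max N N') \<psi>"
      by (rule order_trans[OF 2[OF that]], rule mult_mono)
         (auto simp: that Ck_norm_mono Ck_norm_nonneg)
    ultimately have "norm a * norm (f \<psi>) + norm b * norm (g \<psi>)
        \<le> norm a * (\<bar>C\<bar> * Ck_norm (max N N') \<psi>) + norm b * (\<bar>C'\<bar> * Ck_norm (max N N') \<psi>)"
      by (intro add_mono mult_left_mono) auto
    then show ?thesis
      by (intro order_trans[OF norm_triangle_ineq]) (simp add: norm_mult algebra_simps)
  qed
  then have "\<exists>C N. \<forall>\<psi>\<in>test_functions. norm (a * f \<psi> + b * g \<psi>) \<le> C * Ck_norm N \<psi>" by blast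
  then show ?thesis using assms by (simp add: is_distribution_def algebra_simps)
qed

instantiation pdist :: real_vector
begin

lift_definition zero_pdist :: pdist is "\<lambda>_. 0"
  by (auto simp: is_distribution_def intro!: exI[of _ 0])

lift_definition plus_pdist :: "pdist \<Rightarrow> pdist \<Rightarrow> pdist" is "\<lambda>f g \<psi>. f \<psi> + g \<psi>"
  subgoal for f g using is_distribution_lincomb[of f g 1 1] by simp
  done

lift_definition minus_pdist :: "pdist \<Rightarrow> pdist \<Rightarrow> pdist" is "\<lambda>f g \<psi>. f \<psi> - g \<psi>"
  subgoal for f g using is_distribution_lincomb[of f g 1 "-1"] by simp
  done

lift_definition uminus_pdist :: "pdist \<Rightarrow> pdist" is "\<lambda>f \<psi>. - f \<psi>"
  subgoal for f using is_distribution_lincomb[of f f "-1" 0] by simp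
  done

lift_definition scaleR_pdist :: "real \<Rightarrow> pdist \<Rightarrow> pdist" is "\<lambda>r f \<psi>. of_real r * f \<psi>"
  subgoal for r f using is_distribution_lincomb[of f f "of_real r" 0] by simp
  done

instance
  by standard (transfer; auto simp: algebra_simps scaleR_conv_of_real)+

end

lift_definition dist_deriv :: "pdist \<Rightarrow> pdist" is
  "\<lambda>f \<psi>. if \<psi> \<in> test_functions then - f (vderiv \<psi>) else 0"
proof -
  fix f assume "is_distribution f"
  then have lin: "f (\<lambda>x. \<psi> x + \<theta> x) = f \<psi> + f \<theta>" "f (\<lambda>x. a * \<psi> x) = a * f \<psi>"
    if "\<psi> \<in> test_functions" "\<theta> \<in> test_functions" for \<psi> \<theta> a
    using that by (auto simp: is_distribution_def)
  obtain C N where CN: "\<And>\<psi>. \<psi> \<in> test_functions \<Longrightarrow> norm (f \<psi>) \<le> C * Ck_norm N \<psi>"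
    using \<open>is_distribution f\<close> unfolding is_distribution_def by blast
  have "norm (f (vderiv \<psi>)) \<le> \<bar>C\<bar> * Ck_norm (Suc N) \<psi>" if "\<psi> \<in> test_functions" for \<psi>
    by (rule order_trans[OF CN[OF test_functions_vderiv[OF that]]], rule mult_mono)
       (auto simp: that Ck_norm_vderiv Ck_norm_nonneg test_functions_vderiv)
  then have "\<exists>C N. \<forall>\<psi>\<in>test_functions. norm (f (vderiv \<psi>)) \<le> C * Ck_norm N \<psi>" by blast
  moreover have "vderiv (\<lambda>x. \<psi> x + \<theta> x) = (\<lambda>x. vderiv \<psi> x + vderiv \<theta> x)"
    if "\<psi> \<in> test_functions" "\<theta> \<in> test_functions" for \<psi> \<theta>
    using vderiv_pow_add[OF that, of 1] by simp
  moreover have "vderiv (\<lambda>x. a * \<psi> x) = (\<lambda>x. a * vderiv \<psi> x)"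
    if "\<psi> \<in> test_functions" for \<psi> a
    using vderiv_pow_mult[OF that, of 1] by simp
  ultimately show "is_distribution (\<lambda>\<psi>. if \<psi> \<in> test_functions then - f (vderiv \<psi>) else 0)"
    by (simp add: is_distribution_def test_functions_add test_functions_mult
        test_functions_vderiv lin)
qed


section \<open>Fourier coefficients, multipliers and Sobolev spaces\<close>

text \<open>A function \<open>f\<close> is the distribution \<open>\<psi> \<mapsto> \<integral> f \<psi>\<close> over a period (no complex conjugation).\<close>

definition fourier_coeff :: "pdist \<Rightarrow> int \<Rightarrow> complex" where
  "fourier_coeff f k = pairing f (\<lambda>x. cis (- (of_int k * x))) / (2 * of_real pi)"

text \<open>The distribution \<open>\<Sum>k. m k * fourier_coeff f k * exp (\<i> k x)\<close>; it is meaningful when \<open>m\<close> is of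
  polynomial growth, and then has Fourier coefficients \<open>m k * fourier_coeff f k\<close>
  (\<open>fourier_coeff_multiplier\<close>).\<close>

definition multiplier_functional :: "(int \<Rightarrow> complex) \<Rightarrow> pdist \<Rightarrow> (real \<Rightarrow> complex) \<Rightarrow> complex" where
  "multiplier_functional m f \<psi> =
     (if \<psi> \<in> test_functions
      then \<Sum>\<^sub>\<infinity>k. m k * fourier_coeff f k * integral {-pi..pi} (\<lambda>x. cis (of_int k * x) * \<psi> x)
      else 0)"

definition fourier_multiplier :: "(int \<Rightarrow> complex) \<Rightarrow> pdist \<Rightarrow> pdist" where
  "fourier_multiplier m f = Abs_pdist (multiplier_functional m f)"

lemma vderiv_pow_cis: "(vderiv ^^ n) (\<lambda>x. cis (c * x)) = (\<lambda>x. (\<i> * of_real c) ^ n * cis (c * x))"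
proof (induction n)
  case (Suc n)
  have "((\<lambda>x. (\<i> * of_real c) ^ n * cis (c * x)) has_vector_derivative
          (\<i> * of_real c) ^ n * (\<i> * of_real c * cis (c * x))) (at x)" for x
    unfolding has_vector_derivative_def
    by (auto intro!: derivative_eq_intros simp: fun_eq_iff scaleR_conv_of_real)
  then have "vector_derivative (\<lambda>x. (\<i> * of_real c) ^ n * cis (c * x)) (at x)
      = (\<i> * of_real c) ^ n * (\<i> * of_real c * cis (c * x))" for x
    by (rule vector_derivative_at)
  then show ?case by (simp add: Suc fun_eq_iff)
qed simp

lemma test_functions_cis: "(\<lambda>x. cis (of_int k * x)) \<in> test_functions"
proof -
  have "of_int k * (x + 2 * pi) = of_int k * x + 2 * pi * of_int k" for x :: real
    by (simp add: algebra_simps)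
  then have "cis (of_int k * (x + 2 * pi)) = cis (of_int k * x)" for x
    by (metis cis_mult cis_multiple_2pi Ints_of_int mult.right_neutral)
  moreover have "(\<lambda>x. (\<i> * of_real c) ^ n * cis (c * x)) differentiable at x" for c x n
    by (intro differentiable_mult differentiable_const differentiableI)
       (auto intro!: derivative_eq_intros)
  ultimately show ?thesis unfolding test_functions_def mem_Collect_eq vderiv_pow_cis by blast
qed

lemma Ck_norm_cis_le: "Ck_norm N (\<lambda>x. cis (of_int k * x)) \<le> real (Suc N) * (1 + \<bar>of_int k\<bar>) ^ N"
proof -
  have "(SUP x. norm ((vderiv ^^ n) (\<lambda>x. cis (of_int k * x)) x)) \<le> (1 + \<bar>of_int k\<bar>) ^ N"
    if "n \<le> N" for n
  proof -
    have "\<bar>of_int k\<bar> ^ n \<le> (1 + \<bar>of_int k\<bar> :: real) ^ n" by (rule power_mono) auto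
    also have "\<dots> \<le> (1 + \<bar>of_int k\<bar>) ^ N" by (rule power_increasing) (use that in auto)
    finally show ?thesis unfolding vderiv_pow_cis by (simp add: norm_mult norm_power)
  qed
  then have "Ck_norm N (\<lambda>x. cis (of_int k * x)) \<le> (\<Sum>n\<le>N. (1 + \<bar>of_int k\<bar>) ^ N)"
    unfolding Ck_norm_def by (intro sum_mono) auto
  then show ?thesis by simp
qed

lemma fourier_coeff_growth:
  "\<exists>C N. 0 \<le> C \<and> (\<forall>k. norm (fourier_coeff f k) \<le> C * (1 + \<bar>of_int k\<bar>) ^ N)"
proof -
  have "is_distribution (pairing f)" using pairing by auto
  then obtain C N where CN: "\<And>\<psi>. \<psi> \<in> test_functions \<Longrightarrow> norm (pairing f \<psi>) \<le> C * Ck_norm N \<psi>"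
    unfolding is_distribution_def by blast
  have "norm (fourier_coeff f k) \<le> (\<bar>C\<bar> * real (Suc N)) * (1 + \<bar>of_int k\<bar>) ^ N" for k
  proof -
    let ?e = "\<lambda>x. cis (of_int (-k) * x)"
    have t: "?e \<in> test_functions" by (rule test_functions_cis)
    have "norm (pairing f ?e) \<le> \<bar>C\<bar> * Ck_norm N ?e"
      by (rule order_trans[OF CN[OF t]], rule mult_right_mono) (use Ck_norm_nonneg[OF t] in auto)
    also have "\<dots> \<le> \<bar>C\<bar> * (real (Suc N) * (1 + \<bar>of_int (-k)\<bar>) ^ N)"
      by (intro mult_left_mono Ck_norm_cis_le) auto
    finally have 1: "norm (pairing f ?e) \<le> (\<bar>C\<bar> * real (Suc N)) * (1 + \<bar>of_int k\<bar>) ^ N"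
      by (simp add: mult_ac)
    have "norm (fourier_coeff f k) = norm (pairing f ?e) / (2 * pi)"
      by (simp add: fourier_coeff_def norm_divide norm_mult)
    also have "\<dots> \<le> norm (pairing f ?e)"
      using pi_gt3 by (simp add: divide_le_eq mult_le_cancel_left1)
    finally show ?thesis using 1 by linarith
  qed
  then show ?thesis by (intro exI[of _ "\<bar>C\<bar> * real (Suc N)"] exI[of _ N]) auto
qed

abbreviation osc_int :: "int \<Rightarrow> (real \<Rightarrow> complex) \<Rightarrow> complex" where
  "osc_int k \<psi> \<equiv> integral {-pi..pi} (\<lambda>x. cis (of_int k * x) * \<psi> x)"

lemma test_functions_continuous_on: "\<psi> \<in> test_functions \<Longrightarrow> continuous_on S \<psi>"
proof -
  assume "\<psi> \<in> test_functions"
  then have "\<psi> differentiable at x" for x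
    unfolding test_functions_def by (auto dest: spec[of _ "0::nat"])
  then show ?thesis
    by (intro differentiable_imp_continuous_on differentiable_at_imp_differentiable_on) auto
qed

lemma osc_int_integrable:
  "\<psi> \<in> test_functions \<Longrightarrow> (\<lambda>x. cis (of_int k * x) * \<psi> x) integrable_on {-pi..pi}"
  by (intro integrable_continuous_interval continuous_intros test_functions_continuous_on
      continuous_on_compose2[OF continuous_on_cis]) auto

lemma osc_int_vderiv:
  assumes "\<psi> \<in> test_functions"
  shows "osc_int k (vderiv \<psi>) = - (\<i> * of_int k) * osc_int k \<psi>"
proof -
  let ?e = "\<lambda>x. cis (of_int k * x)"
  have de: "(?e has_vector_derivative \<i> * of_int k * ?e x) (at x)" for x
    unfolding has_vector_derivative_def
    by (auto intro!: derivative_eq_intros simp: fun_eq_iff scaleR_conv_of_real)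
  have dp: "(\<psi> has_vector_derivative vderiv \<psi> x) (at x)" for x
    using assms unfolding test_functions_def
    by (auto simp: vector_derivative_works[symmetric] dest: spec[of _ "0::nat"])
  have "((\<lambda>x. ?e x * \<psi> x) has_vector_derivative (?e x * vderiv \<psi> x + \<i> * of_int k * ?e x * \<psi> x)) (at x)" for x
    by (rule has_vector_derivative_mult[OF de dp, THEN has_vector_derivative_eq_rhs]) simp
  then have "((\<lambda>x. ?e x * vderiv \<psi> x + \<i> * of_int k * ?e x * \<psi> x) has_integral
      (?e pi * \<psi> pi - ?e (-pi) * \<psi> (-pi))) {-pi..pi}"
    by (intro fundamental_theorem_of_calculus) (auto intro: has_vector_derivative_at_within)
  moreover have "?e pi = ?e (-pi)" "\<psi> pi = \<psi> (-pi)"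
    using test_functions_periodic_deriv[OF test_functions_cis, of 0 k "-pi"]
      test_functions_periodic_deriv[OF assms, of 0 "-pi"] by simp_all
  ultimately have "((\<lambda>x. ?e x * vderiv \<psi> x + \<i> * of_int k * (?e x * \<psi> x)) has_integral 0) {-pi..pi}"
    by (simp add: mult.assoc)
  moreover have "((\<lambda>x. ?e x * vderiv \<psi> x + \<i> * of_int k * (?e x * \<psi> x)) has_integral
     (osc_int k (vderiv \<psi>) + \<i> * of_int k * osc_int k \<psi>)) {-pi..pi}"
    by (intro has_integral_add has_integral_mult_right integrable_integral osc_int_integrable
        assms test_functions_vderiv)
  ultimately have "osc_int k (vderiv \<psi>) + \<i> * of_int k * osc_int k \<psi> = 0"
    using has_integral_unique by blast
  then show ?thesis by (simp add: eq_neg_iff_add_eq_0)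
qed

lemma osc_int_bound:
  assumes "\<psi> \<in> test_functions" "\<And>x. norm (\<psi> x) \<le> B"
  shows "norm (osc_int k \<psi>) \<le> 2 * pi * B"
proof -
  have "norm (osc_int k \<psi>) \<le> B * (pi - - pi)"
    by (rule integral_bound)
       (auto simp: norm_mult assms(2) intro!: continuous_intros
         test_functions_continuous_on[OF assms(1)])
  then show ?thesis by (simp add: mult.commute)
qed

lemma osc_int_decay:
  assumes "\<psi> \<in> test_functions"
  shows "\<bar>of_int k\<bar> ^ n * norm (osc_int k \<psi>) \<le> 2 * pi * Ck_norm n \<psi>"
proof -
  have *: "\<phi> \<in> test_functions \<Longrightarrow> (vderiv ^^ n) \<phi> \<in> test_functions \<and>
     norm (osc_int k ((vderiv ^^ n) \<phi>)) = \<bar>of_int k\<bar> ^ n * norm (osc_int k \<phi>)" for \<phi>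
  proof (induction n)
    case (Suc n)
    then show ?case using test_functions_vderiv[of "(vderiv ^^ n) \<phi>"]
        osc_int_vderiv[of "(vderiv ^^ n) \<phi>" k] by (simp add: norm_mult)
  qed simp
  show ?thesis using *[OF assms] osc_int_bound[of "(vderiv ^^ n) \<psi>" "Ck_norm n \<psi>" k]
      Ck_norm_ge[OF assms order_refl, of n] by auto
qed

lemma osc_int_decay':
  assumes "\<psi> \<in> test_functions"
  shows "(1 + \<bar>of_int k\<bar>) ^ n * norm (osc_int k \<psi>) \<le> 2 ^ n * (4 * pi) * Ck_norm n \<psi>"
proof -
  let ?a = "\<bar>of_int k\<bar> :: real" and ?o = "norm (osc_int k \<psi>)"
  have "(1 + ?a) ^ n \<le> (2 * max 1 ?a) ^ n" by (rule power_mono) auto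
  also have "\<dots> \<le> 2 ^ n * (1 + ?a ^ n)"
    by (auto simp: power_mult_distrib max_def)
  finally have "(1 + ?a) ^ n * ?o \<le> 2 ^ n * (1 + ?a ^ n) * ?o"
    by (intro mult_right_mono) auto
  also have "\<dots> = 2 ^ n * (?a ^ 0 * ?o + ?a ^ n * ?o)" by (simp add: algebra_simps)
  also have "\<dots> \<le> 2 ^ n * (2 * pi * Ck_norm 0 \<psi> + 2 * pi * Ck_norm n \<psi>)"
    by (intro mult_left_mono add_mono osc_int_decay assms) auto
  also have "\<dots> \<le> 2 ^ n * (2 * pi * Ck_norm n \<psi> + 2 * pi * Ck_norm n \<psi>)"
    by (intro mult_left_mono add_mono Ck_norm_mono assms) auto
  finally show ?thesis by (simp add: algebra_simps)
qed

lemma inverse_square_int_summable: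
  "(\<lambda>k::int. 1 / (1 + \<bar>of_int k\<bar> :: real)\<^sup>2) summable_on UNIV"
proof -
  let ?f = "\<lambda>k::int. 1 / (1 + \<bar>of_int k\<bar> :: real)\<^sup>2"
  have "summable (\<lambda>n. inverse (real (Suc n) ^ 2))"
    using inverse_power_summable[of 2, where 'a=real] by (subst summable_Suc_iff) auto
  then have n: "(\<lambda>n. 1 / (1 + real n)\<^sup>2) summable_on UNIV"
    by (subst summable_on_UNIV_nonneg_real_iff) (auto simp: inverse_eq_divide)
  have "?f summable_on (range int)"
    by (subst summable_on_reindex) (use n in \<open>auto simp: o_def\<close>)
  moreover have "?f summable_on (range (\<lambda>n. - int n))"
    by (subst summable_on_reindex) (use n in \<open>auto simp: o_def inj_def\<close>)
  ultimately have "?f summable_on (range int \<union> range (\<lambda>n. - int n))"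
    by (rule summable_on_union)
  moreover have "range int \<union> range (\<lambda>n. - int n) = (UNIV :: int set)"
  proof -
    have "k \<in> range int \<or> k \<in> range (\<lambda>n. - int n)" for k :: int
      by (cases k rule: int_cases2) auto
    then show ?thesis by auto
  qed
  ultimately show ?thesis by simp
qed

lemma synthesis_bound:
  assumes "\<And>k. norm (c k) \<le> C * (1 + \<bar>of_int k\<bar>) ^ N" "0 \<le> C" "\<psi> \<in> test_functions"
  shows "norm (c k * osc_int k \<psi>) \<le>
    (C * (2 ^ (N + 2) * (4 * pi))) * Ck_norm (N + 2) \<psi> * (1 / (1 + \<bar>of_int k\<bar>)\<^sup>2)"
proof -
  let ?a = "1 + \<bar>of_int k\<bar> :: real"
  have "norm (c k * osc_int k \<psi>) * ?a\<^sup>2 \<le> C * ?a ^ N * norm (osc_int k \<psi>) * ?a\<^sup>2"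
    unfolding norm_mult by (intro mult_right_mono assms) auto
  also have "\<dots> = C * (?a ^ (N + 2) * norm (osc_int k \<psi>))" by (simp add: power_add power2_eq_square mult_ac)
  also have "\<dots> \<le> C * (2 ^ (N + 2) * (4 * pi) * Ck_norm (N + 2) \<psi>)"
    by (intro mult_left_mono osc_int_decay' assms)
  finally have "norm (c k * osc_int k \<psi>) \<le> C * (2 ^ (N + 2) * (4 * pi) * Ck_norm (N + 2) \<psi>) / ?a\<^sup>2"
    by (subst pos_le_divide_eq) auto
  then show ?thesis by (simp add: mult_ac)
qed

lemma synthesis_abs_summable:
  assumes "\<And>k. norm (c k) \<le> C * (1 + \<bar>of_int k\<bar>) ^ N" "0 \<le> C" "\<psi> \<in> test_functions"
  shows "(\<lambda>k. norm (c k * osc_int k \<psi>)) summable_on UNIV"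
  by (rule summable_on_comparison_test[OF summable_on_cmult_right[OF inverse_square_int_summable]
        synthesis_bound[OF assms]]) auto

lemma is_distribution_synthesis:
  assumes c: "\<And>k. norm (c k) \<le> C * (1 + \<bar>of_int k\<bar>) ^ N" "0 \<le> C"
  shows "is_distribution (\<lambda>\<psi>. if \<psi> \<in> test_functions then \<Sum>\<^sub>\<infinity>k. c k * osc_int k \<psi> else 0)"
proof -
  note sm = abs_summable_summable[OF synthesis_abs_summable[OF c]]
  have add: "osc_int k (\<lambda>x. \<psi> x + \<theta> x) = osc_int k \<psi> + osc_int k \<theta>"
    if "\<psi> \<in> test_functions" "\<theta> \<in> test_functions" for k \<psi> \<theta>
    using integral_add[OF osc_int_integrable[OF that(1), of k] osc_int_integrable[OF that(2), of k]]
    by (simp add: distrib_left)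
  have mult: "osc_int k (\<lambda>x. a * \<psi> x) = a * osc_int k \<psi>" for k \<psi> a
    by (subst integral_mult_right[symmetric]) (simp add: mult_ac)
  define S where "S = (\<Sum>\<^sub>\<infinity>k::int. 1 / (1 + \<bar>of_int k\<bar> :: real)\<^sup>2)"
  let ?K = "C * (2 ^ (N + 2) * (4 * pi))"
  have "norm (\<Sum>\<^sub>\<infinity>k. c k * osc_int k \<psi>) \<le> ?K * S * Ck_norm (N + 2) \<psi>"
    if t: "\<psi> \<in> test_functions" for \<psi>
  proof -
    have "norm (\<Sum>\<^sub>\<infinity>k. c k * osc_int k \<psi>) \<le> (\<Sum>\<^sub>\<infinity>k. norm (c k * osc_int k \<psi>))"
      by (rule norm_infsum_bound[OF synthesis_abs_summable[OF c t]])
    also have "\<dots> \<le> (\<Sum>\<^sub>\<infinity>k. ?K * Ck_norm (N + 2) \<psi> * (1 / (1 + \<bar>of_int k\<bar>)\<^sup>2))"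
      by (intro infsum_mono synthesis_abs_summable[OF c t] synthesis_bound[OF c t]
          summable_on_cmult_right inverse_square_int_summable)
    also have "\<dots> = ?K * Ck_norm (N + 2) \<psi> * S"
      unfolding S_def by (rule infsum_cmult_right') 
    finally show ?thesis by (simp add: mult_ac)
  qed
  then have "\<exists>C N. \<forall>\<psi>\<in>test_functions. norm (\<Sum>\<^sub>\<infinity>k. c k * osc_int k \<psi>) \<le> C * Ck_norm N \<psi>"
    by blast
  moreover have "(\<Sum>\<^sub>\<infinity>k. c k * osc_int k (\<lambda>x. \<psi> x + \<theta> x))
      = (\<Sum>\<^sub>\<infinity>k. c k * osc_int k \<psi>) + (\<Sum>\<^sub>\<infinity>k. c k * osc_int k \<theta>)"
    if "\<psi> \<in> test_functions" "\<theta> \<in> test_functions" for \<psi> \<theta>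
  proof -
    have "c k * osc_int k (\<lambda>x. \<psi> x + \<theta> x) = c k * osc_int k \<psi> + c k * osc_int k \<theta>" for k
      by (subst add[OF that]) (rule distrib_left)
    then show ?thesis by (simp only: infsum_add[OF sm sm, OF that])
  qed
  moreover have "(\<Sum>\<^sub>\<infinity>k. c k * osc_int k (\<lambda>x. a * \<psi> x)) = a * (\<Sum>\<^sub>\<infinity>k. c k * osc_int k \<psi>)" for \<psi> a
  proof -
    have "c k * osc_int k (\<lambda>x. a * \<psi> x) = a * (c k * osc_int k \<psi>)" for k
      by (subst mult) (rule mult.left_commute)
    then show ?thesis by (simp only: infsum_cmult_right')
  qed
  ultimately show ?thesis unfolding is_distribution_def
    by (simp add: test_functions_add test_functions_mult)
qed

lemma osc_int_cis: "osc_int j (\<lambda>x. cis (- (of_int k * x))) = (if j = k then 2 * of_real pi else 0)"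
proof (cases "j = k")
  case True
  then show ?thesis by (simp add: cis_mult scaleR_conv_of_real)
next
  case False
  have "osc_int (j - k) (vderiv (\<lambda>x. 1)) = - (\<i> * of_int (j - k)) * osc_int (j - k) (\<lambda>x. 1)"
    by (rule osc_int_vderiv) (use test_functions_cis[of 0] in simp)
  then have "osc_int (j - k) (\<lambda>x. 1) = 0" using False by simp
  moreover have "cis (of_int (j - k) * x) * 1 = cis (of_int j * x) * cis (- (of_int k * x))" for x
    by (simp add: cis_mult algebra_simps)
  ultimately show ?thesis using False by simp
qed

lemma is_distribution_multiplier:
  assumes "\<And>k. norm (m k) \<le> C * (1 + \<bar>of_int k\<bar>) ^ N"
  shows "is_distribution (multiplier_functional m f)"
proof -
  obtain C' N' where f: "0 \<le> C'" "\<And>k. norm (fourier_coeff f k) \<le> C' * (1 + \<bar>of_int k\<bar>) ^ N'"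
    using fourier_coeff_growth[of f] by auto
  have C: "0 \<le> C" using order_trans[OF norm_ge_zero assms[of 0]] by simp
  have "norm (m k * fourier_coeff f k) \<le> (C * C') * (1 + \<bar>of_int k\<bar>) ^ (N + N')" for k
    using mult_mono[OF assms[of k] f(2)[of k]] C f(1)
    by (simp add: norm_mult power_add mult_ac)
  then have "is_distribution (\<lambda>\<psi>. if \<psi> \<in> test_functions
      then \<Sum>\<^sub>\<infinity>k. (m k * fourier_coeff f k) * osc_int k \<psi> else 0)"
    by (rule is_distribution_synthesis) (use C f(1) in simp)
  then show ?thesis by (simp add: multiplier_functional_def[abs_def])
qed

lemma fourier_coeff_multiplier:
  assumes "\<And>k. norm (m k) \<le> C * (1 + \<bar>of_int k\<bar>) ^ N"
  shows "fourier_coeff (fourier_multiplier m f) k = m k * fourier_coeff f k"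
proof -
  have t: "(\<lambda>x. cis (- (of_int k * x))) \<in> test_functions"
    using test_functions_cis[of "-k"] by simp
  have "pairing (fourier_multiplier m f) = multiplier_functional m f"
    unfolding fourier_multiplier_def
    by (rule Abs_pdist_inverse) (use is_distribution_multiplier[OF assms] in simp)
  then have "pairing (fourier_multiplier m f) (\<lambda>x. cis (- (of_int k * x)))
      = (\<Sum>\<^sub>\<infinity>j. m j * fourier_coeff f j * (if j = k then 2 * of_real pi else 0))"
    using t by (simp add: multiplier_functional_def osc_int_cis)
  also have "\<dots> = (\<Sum>\<^sub>\<infinity>j\<in>{k}. m j * fourier_coeff f j * (if j = k then 2 * of_real pi else 0))"
    by (rule infsum_cong_neutral) auto
  finally show ?thesis by (simp add: fourier_coeff_def)
qed

definition sobolev :: "real \<Rightarrow> pdist set" where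
  "sobolev s =
     {f. (\<lambda>k::int. ((1 + (of_int k)\<^sup>2) powr (s / 2) * norm (fourier_coeff f k))\<^sup>2) summable_on UNIV}"

definition sobolev_norm :: "real \<Rightarrow> pdist \<Rightarrow> real" where
  "sobolev_norm s f =
     sqrt (2 * pi) *
     sqrt (\<Sum>\<^sub>\<infinity>k::int. ((1 + (of_int k)\<^sup>2) powr (s / 2) * norm (fourier_coeff f k))\<^sup>2)"

text \<open>\<open>w\<close> is the square of the distribution \<open>u\<close>: its Fourier coefficients are the absolutely convergent
  self-convolution of those of \<open>u\<close>. For \<open>s < 0\<close> this is a restriction on \<open>u\<close>.\<close>

definition is_square :: "pdist \<Rightarrow> pdist \<Rightarrow> bool" where
  "is_square u w \<longleftrightarrow>
     (\<forall>k. ((\<lambda>j. fourier_coeff u j * fourier_coeff u (k - j)) has_sum fourier_coeff w k) UNIV)"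

text \<open>The integral of a distribution-valued function is taken in the weak sense, i.e. after pairing
  with an arbitrary test function.\<close>

definition has_weak_integral :: "(real \<Rightarrow> pdist) \<Rightarrow> pdist \<Rightarrow> real \<Rightarrow> real \<Rightarrow> bool" where
  "has_weak_integral F I a b \<longleftrightarrow>
     (\<forall>\<psi>\<in>test_functions.
        has_bochner_integral (lebesgue_on {a..b}) (\<lambda>t. pairing (F t) \<psi>) (pairing I \<psi>))"


section \<open>Maps of class \<open>C\<^sup>2\<close> between normed spaces given by a subspace and a norm\<close>

definition bounded_linear_map ::
  "'a::real_vector set \<Rightarrow> ('a \<Rightarrow> real) \<Rightarrow> 'b::real_vector set \<Rightarrow> ('b \<Rightarrow> real) \<Rightarrow> ('a \<Rightarrow> 'b) \<Rightarrow> bool" where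
  "bounded_linear_map X NX Y NY L \<longleftrightarrow>
     (\<forall>v\<in>X. L v \<in> Y) \<and>
     (\<forall>v\<in>X. \<forall>w\<in>X. L (v + w) = L v + L w) \<and>
     (\<forall>v\<in>X. \<forall>r. L (r *\<^sub>R v) = r *\<^sub>R L v) \<and>
     (\<exists>K. \<forall>v\<in>X. NY (L v) \<le> K * NX v)"

definition bounded_bilinear_map ::
  "'a::real_vector set \<Rightarrow> ('a \<Rightarrow> real) \<Rightarrow> 'b::real_vector set \<Rightarrow> ('b \<Rightarrow> real) \<Rightarrow>
     ('a \<Rightarrow> 'a \<Rightarrow> 'b) \<Rightarrow> bool" where
  "bounded_bilinear_map X NX Y NY B \<longleftrightarrow>
     (\<forall>v\<in>X. bounded_linear_map X NX Y NY (B v)) \<and>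
     (\<forall>w\<in>X. bounded_linear_map X NX Y NY (\<lambda>v. B v w)) \<and>
     (\<exists>K. \<forall>v\<in>X. \<forall>w\<in>X. NY (B v w) \<le> K * NX v * NX w)"

text \<open>\<open>D1 x\<close> is the Frechet derivative of \<open>F\<close> at \<open>x\<close>, and \<open>D2 x\<close> is that of \<open>D1\<close> for the operator norm on
  the bounded linear maps from \<open>X\<close> to \<open>Y\<close>, written as a bounded bilinear map. A bound on an operator norm
  is expressed by the corresponding bound on all vectors.\<close>

definition C2_map ::
  "'a::real_vector set \<Rightarrow> ('a \<Rightarrow> real) \<Rightarrow> 'b::real_vector set \<Rightarrow> ('b \<Rightarrow> real) \<Rightarrow> ('a \<Rightarrow> 'b) \<Rightarrow> bool" where
  "C2_map X NX Y NY F \<longleftrightarrow>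
     (\<forall>x\<in>X. F x \<in> Y) \<and>
     (\<exists>D1 D2.
        (\<forall>x\<in>X. bounded_linear_map X NX Y NY (D1 x)) \<and>
        (\<forall>x\<in>X. bounded_bilinear_map X NX Y NY (D2 x)) \<and>
        (\<forall>x\<in>X. \<forall>\<epsilon>>0. \<exists>\<delta>>0. \<forall>h\<in>X. NX h < \<delta> \<longrightarrow>
            NY (F (x + h) - F x - D1 x h) \<le> \<epsilon> * NX h) \<and>
        (\<forall>x\<in>X. \<forall>\<epsilon>>0. \<exists>\<delta>>0. \<forall>h\<in>X. NX h < \<delta> \<longrightarrow>
            (\<forall>v\<in>X. NY (D1 (x + h) v - D1 x v - D2 x h v) \<le> \<epsilon> * NX h * NX v)) \<and>
        (\<forall>x\<in>X. \<forall>\<epsilon>>0. \<exists>\<delta>>0. \<forall>h\<in>X. NX h < \<delta> \<longrightarrow>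
            (\<forall>v\<in>X. \<forall>w\<in>X. NY (D2 (x + h) v w - D2 x v w) \<le> \<epsilon> * NX v * NX w)))"


section \<open>The Chen-Lee equation\<close>

text \<open>The Hilbert transform has symbol \<open>\<i> sgn k\<close>, so \<open>\<i> q(k) - p(k)\<close> below is the symbol of
  \<open>- \<beta> H \<partial>\<^sub>x\<^sup>2 - \<eta> (H \<partial>\<^sub>x - \<partial>\<^sub>x\<^sup>2)\<close>, the linear part of
  \<open>u\<^sub>t + u u\<^sub>x + \<beta> H u\<^sub>x\<^sub>x + \<eta> (H u\<^sub>x - u\<^sub>x\<^sub>x) = 0\<close>.\<close>

definition chen_lee_q :: "real \<Rightarrow> int \<Rightarrow> real" where
  "chen_lee_q \<beta> k = \<beta> * of_int k * \<bar>of_int k\<bar>"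

definition chen_lee_p :: "real \<Rightarrow> int \<Rightarrow> real" where
  "chen_lee_p \<eta> k = \<eta> * ((of_int k)\<^sup>2 - \<bar>of_int k\<bar>)"

definition chen_lee_semigroup :: "real \<Rightarrow> real \<Rightarrow> real \<Rightarrow> pdist \<Rightarrow> pdist" where
  "chen_lee_semigroup \<beta> \<eta> t =
     fourier_multiplier
       (\<lambda>k. exp (\<i> * of_real (chen_lee_q \<beta> k * t) - of_real (chen_lee_p \<eta> k * t)))"

lemma fourier_coeff_chen_lee_semigroup:
  assumes "0 \<le> \<eta>" "0 \<le> t"
  shows "fourier_coeff (chen_lee_semigroup \<beta> \<eta> t f) k =
    exp (\<i> * of_real (chen_lee_q \<beta> k * t) - of_real (chen_lee_p \<eta> k * t)) * fourier_coeff f k"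
  unfolding chen_lee_semigroup_def
proof (rule fourier_coeff_multiplier[where C = 1 and N = 0])
  fix k :: int
  have "0 \<le> chen_lee_p \<eta> k"
  proof -
    have "\<bar>k\<bar> \<le> k\<^sup>2"
    proof (cases "k = 0")
      case False
      then have "\<bar>k\<bar> \<le> \<bar>k\<bar>\<^sup>2" by (intro self_le_power) auto
      then show ?thesis by simp
    qed simp
    then have "\<bar>of_int k\<bar> \<le> (of_int k :: real)\<^sup>2"
      by (metis of_int_abs of_int_le_iff of_int_power)
    then show ?thesis using assms by (simp add: chen_lee_p_def)
  qed
  then show "norm (exp (\<i> * of_real (chen_lee_q \<beta> k * t) - of_real (chen_lee_p \<eta> k * t)))
      \<le> 1 * (1 + \<bar>of_int k\<bar>) ^ 0"
    using assms by (simp add: norm_exp)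
qed

text \<open>Solutions are taken in \<open>C([0,T]; H\<^sup>s)\<close>. The integral equation needs \<open>u(t')\<^sup>2\<close>, and this has to exist for
  almost every \<open>t'\<close>; \<open>w\<close> is the function \<open>t' \<mapsto> u(t')\<^sup>2\<close>.\<close>

definition chen_lee_solution ::
  "real \<Rightarrow> real \<Rightarrow> real \<Rightarrow> real \<Rightarrow> pdist \<Rightarrow> (real \<Rightarrow> pdist) \<Rightarrow> bool" where
  "chen_lee_solution \<beta> \<eta> s T \<phi> u \<longleftrightarrow>
     (\<forall>t\<in>{0..T}. u t \<in> sobolev s \<and>
        ((\<lambda>t'. sobolev_norm s (u t' - u t)) \<longlongrightarrow> 0) (at t within {0..T})) \<and>
     (\<exists>w. (AE t in lebesgue_on {0..T}. is_square (u t) (w t)) \<and>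
        (\<forall>t\<in>{0..T}. \<exists>I.
           has_weak_integral
             (\<lambda>t'. chen_lee_semigroup \<beta> \<eta> (t - t') ((1 / 2) *\<^sub>R dist_deriv (w t'))) I 0 t \<and>
           u t = chen_lee_semigroup \<beta> \<eta> t \<phi> - I))"

definition is_flow_map ::
  "real \<Rightarrow> real \<Rightarrow> real \<Rightarrow> real \<Rightarrow> (real \<Rightarrow> pdist \<Rightarrow> pdist) \<Rightarrow> bool" where
  "is_flow_map \<beta> \<eta> s T \<Phi> \<longleftrightarrow>
     (\<forall>\<phi>\<in>sobolev s.
        chen_lee_solution \<beta> \<eta> s T \<phi> (\<lambda>t. \<Phi> t \<phi>) \<and>
        (\<forall>v. chen_lee_solution \<beta> \<eta> s T \<phi> v \<longrightarrow> (\<forall>t\<in>{0..T}. v t = \<Phi> t \<phi>)))"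

end

theory Submission
  imports Defs
begin

text \<open>Expand the flow in the size of the data. If \<open>\<Phi> T\<close> had a second differential at \<open>0\<close>, the term of order
\<open>r\<^sup>2\<close> in \<open>\<Phi> T (r \<phi>)\<close> would be a bounded quadratic form of \<open>\<phi>\<close> on \<open>H\<^sup>s\<close>. This term is minus the Duhamel
integral \<open>\<integral> S(T - \<tau>) \<partial>\<^sub>x (S(\<tau>) \<phi>)\<^sup>2 / 2\<close>. Take \<open>\<phi> = exp (\<i> (m + 1) x) + exp (- \<i> m x)\<close>, whose squared \<open>H\<^sup>s\<close> norm
is of order \<open>m\<^bsup>2s\<^esup>\<close>. The two waves interact to produce the frequency \<open>1\<close>, which the semigroup does not damp
(\<open>p(1) = 0\<close>), while each of the waves survives for a time of order \<open>m\<^bsup>-2\<^esup>\<close> only. The Fourier coefficient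
of the integral at \<open>1\<close> is therefore of order \<open>m\<^bsup>-2\<^esup>\<close>, which is not \<open>O(m\<^bsup>2s\<^esup>)\<close> when \<open>s < -1\<close>
(\<open>sobolev_norm_two_modes\<close>, \<open>duhamel_two_modes_lower\<close>).

The delicate point is the expansion itself. The square of a distribution is not a continuous, or even
everywhere defined, operation on \<open>H\<^sup>s\<close> with \<open>s < 0\<close>, so the integral equation cannot simply be
differentiated. Instead, for small data with rapidly decaying coefficients a classical solution is
constructed by the contraction principle, with a remainder \<open>O(r\<^sup>3)\<close>, and the uniqueness clause of
\<^const>\<open>is_flow_map\<close> identifies it with the flow. The contraction takes place in the space of families
\<open>u(k, t)\<close> of continuous functions of time bounded by a multiple of \<open>(1 + \<bar>k\<bar>)\<^bsup>-2\<^esup>\<close>, uniformly in \<open>t\<close>. This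
weight is stable under convolution (\<open>norm_conv_le\<close>), and the factor \<open>k\<close> from the derivative is absorbed by
the dissipation in time (\<open>smoothing_integral\<close>); hence the Duhamel operator is a bounded bilinear operator on
a Banach space (\<open>bounded_bilinear_duhamel\<close>), and \<open>quadratic_perturbation\<close> applies. The result is
\<open>flow_map_expansion\<close>.

On the side of the \<open>C\<^sup>2\<close> hypothesis, it suffices to look at one Fourier coefficient along the line
\<open>r \<mapsto> r \<phi>\<close>: a curve whose second derivative at \<open>0\<close> is given by \<open>D2 0 \<phi> \<phi>\<close> and is also twice the
coefficient of \<open>r\<^sup>2\<close> in the expansion (\<open>C2_map_second_coeff_bounded\<close>).\<close>

section \<open>Series depending on a real parameter\<close>

lemma continuous_on_infsum:
  fixes f :: "'a \<Rightarrow> 'b::topological_space \<Rightarrow> 'c::banach"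
  assumes "\<And>k. continuous_on A (f k)" "\<And>k t. t \<in> A \<Longrightarrow> norm (f k t) \<le> M k" "M summable_on UNIV"
  shows "continuous_on A (\<lambda>t. \<Sum>\<^sub>\<infinity>k. f k t)"
proof (rule uniform_limit_theorem)
  show "uniform_limit A (\<lambda>K t. \<Sum>k\<in>K. f k t) (\<lambda>t. \<Sum>\<^sub>\<infinity>k. f k t) (finite_subsets_at_top UNIV)"
    by (rule Weierstrass_m_test_general[where M = M]) (use assms in auto)
  show "\<forall>\<^sub>F K in finite_subsets_at_top UNIV. continuous_on A (\<lambda>t. \<Sum>k\<in>K. f k t)"
    by (intro always_eventually allI continuous_on_sum assms(1))
qed simp

lemma integral_infsum:
  fixes f :: "'a \<Rightarrow> real \<Rightarrow> 'c::banach"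
  assumes c: "\<And>k. continuous_on {a..b} (f k)" and M: "\<And>k t. t \<in> {a..b} \<Longrightarrow> norm (f k t) \<le> M k"
    and s: "M summable_on UNIV"
  shows "integral {a..b} (\<lambda>t. \<Sum>\<^sub>\<infinity>k. f k t) = (\<Sum>\<^sub>\<infinity>k. integral {a..b} (f k))"
proof -
  have u: "uniform_limit {a..b} (\<lambda>K t. \<Sum>k\<in>K. f k t) (\<lambda>t. \<Sum>\<^sub>\<infinity>k. f k t) (finite_subsets_at_top UNIV)"
    by (rule Weierstrass_m_test_general[where M = M]) (use assms in auto)
  obtain I J where I: "\<And>K. ((\<lambda>t. \<Sum>k\<in>K. f k t) has_integral I K) {a..b}"
    and J: "((\<lambda>t. \<Sum>\<^sub>\<infinity>k. f k t) has_integral J) {a..b}"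
    and lim: "(I \<longlongrightarrow> J) (finite_subsets_at_top UNIV)"
    by (rule uniform_limit_integral[OF u continuous_on_sum[OF c]]) auto
  have "I = sum (\<lambda>k. integral {a..b} (f k))"
  proof
    fix K
    show "I K = sum (\<lambda>k. integral {a..b} (f k)) K"
    proof (cases "finite K")
      case True
      then have "((\<lambda>t. \<Sum>k\<in>K. f k t) has_integral (\<Sum>k\<in>K. integral {a..b} (f k))) {a..b}"
        by (intro has_integral_sum integrable_integral integrable_continuous_interval c)
      with I show ?thesis using has_integral_unique by blast
    next
      case False
      then show ?thesis using I[of K] by simp
    qed
  qed
  then have "((\<lambda>k. integral {a..b} (f k)) has_sum J) UNIV"
    using lim by (simp add: has_sum_def )
  then show ?thesis using J by (simp add: infsumI integral_unique)
qed

lemma has_bochner_integral_continuous_interval: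
  fixes f :: "real \<Rightarrow> complex"
  assumes "continuous_on {a..b} f"
  shows "has_bochner_integral (lebesgue_on {a..b}) f (integral {a..b} f)"
proof -
  have "f absolutely_integrable_on {a..b}"
    using absolutely_integrable_continuous[of a b f] assms by simp
  then have "integrable (lebesgue_on {a..b}) f"
    by (simp add: set_integrable_def integrable_restrict_space)
  then show ?thesis
    by (simp add: has_bochner_integral_iff lebesgue_integral_eq_integral)
qed

section \<open>Small solutions of quadratic equations\<close>

text \<open>A Cauchy sequence for the supremum distance converges uniformly, and uniform limits of bounded continuous
functions are bounded and continuous. The lemma is for the topological domain \<open>int \<times> real\<close>.\<close>

lemma complete_bcontfun:
  "complete (UNIV :: ('a::topological_space, 'b::complete_space) bcontfun set)"
proof (rule completeI)
  fix f :: "nat \<Rightarrow> ('a, 'b) bcontfun"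
  assume "Cauchy f"
  then obtain g where "uniform_limit UNIV (\<lambda>n. apply_bcontfun (f n)) g sequentially"
    using uniformly_convergent_eq_cauchy[of "\<lambda>_. True" "\<lambda>n. apply_bcontfun (f n)"]
    unfolding Cauchy_def uniform_limit_sequentially_iff
    by (metis dist_fun_lt_imp_dist_val_lt)
  from uniform_limit_bcontfunE[OF this sequentially_bot]
  obtain l where "f \<longlonglongrightarrow> l" by metis
  then show "\<exists>l\<in>UNIV. f \<longlonglongrightarrow> l" by blast
qed

text \<open>On the ball of radius \<open>2 \<parallel>g\<parallel>\<close> the map \<open>u \<mapsto> g - B u u\<close> is a contraction if \<open>\<parallel>g\<parallel>\<close> is small compared with the
inverse of the bound of \<open>B\<close>. The fixed point differs from \<open>g\<close> by \<open>O(\<parallel>g\<parallel>\<^sup>2)\<close>, and inserting this once more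
into \<open>B\<close> gives the quadratic term up to \<open>O(\<parallel>g\<parallel>\<^sup>3)\<close>.\<close>

lemma quadratic_perturbation:
  fixes B :: "'x::real_normed_vector \<Rightarrow> 'x \<Rightarrow> 'x"
  assumes "bounded_bilinear B" and complete: "complete (UNIV :: 'x set)"
  obtains r C where "0 < r" "0 \<le> C"
    "\<And>g. norm g < r \<Longrightarrow> \<exists>u. u = g - B u u \<and> norm (u - (g - B g g)) \<le> C * norm g ^ 3"
proof -
  interpret bounded_bilinear B by (rule assms(1))
  obtain K where K: "0 < K" "\<And>x y. norm (B x y) \<le> norm x * norm y * K"
    using pos_bounded by blast
  have main: "\<exists>u. u = g - B u u \<and> norm (u - (g - B g g)) \<le> 12 * K\<^sup>2 * norm g ^ 3"
    if g: "norm g < 1 / (8 * K)" for g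
  proof -
    let ?n = "norm g"
    \<comment> \<open>On the ball of radius \<open>2 \<parallel>g\<parallel>\<close> the Lipschitz constant is \<open>4 K \<parallel>g\<parallel>\<close>, hence at most \<open>1 / 2\<close>.\<close>
    have gK: "8 * K * ?n \<le> 1" using g K(1) by (simp add: field_simps)
    have Bb: "norm (B x y) \<le> a * b * K" if "norm x \<le> a" "norm y \<le> b" for x y a b
    proof -
      have "0 \<le> a" using that(1) norm_ge_zero order_trans by blast
      then have "norm x * norm y * K \<le> a * b * K"
        using that K(1) by (intro mult_right_mono mult_mono) auto
      then show ?thesis using K(2) order_trans by blast
    qed
    have "\<exists>!u. u \<in> cball 0 (2 * ?n) \<and> g - B u u = u"
    proof (rule Banach_fix[where c = "1/2"])
      show "complete (cball 0 (2 * ?n) :: 'x set)" by (rule complete_closed_subset[OF closed_cball subset_UNIV complete])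
      show "(\<lambda>u. g - B u u) ` cball 0 (2 * ?n) \<subseteq> cball 0 (2 * ?n)"
      proof clarify
        fix u :: 'x assume "u \<in> cball 0 (2 * ?n)"
        then have "norm (B u u) \<le> (2 * ?n) * (2 * ?n) * K" by (intro Bb) auto
        also have "\<dots> = (8 * K * ?n) * ?n / 2" by simp
        also have "\<dots> \<le> 1 * ?n / 2" by (intro divide_right_mono mult_right_mono gK) auto
        finally show "g - B u u \<in> cball 0 (2 * ?n)"
          using norm_triangle_ineq4[of g "B u u"] norm_ge_zero[of g]
          unfolding mem_cball dist_0_norm by linarith
      qed
      fix u v :: 'x assume "u \<in> cball 0 (2 * ?n)" "v \<in> cball 0 (2 * ?n)"
      then have uv: "norm u \<le> 2 * ?n" "norm v \<le> 2 * ?n" by auto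
      have "dist (g - B u u) (g - B v v) = norm (B (v - u) v + B u (v - u))"
        by (simp add: dist_norm diff_left diff_right)
      also have "\<dots> \<le> norm (u - v) * (2 * ?n) * K + (2 * ?n) * norm (u - v) * K"
        by (intro order_trans[OF norm_triangle_ineq] add_mono Bb uv) (auto simp: norm_minus_commute)
      also have "\<dots> = (8 * K * ?n) * norm (u - v) / 2" by (simp add: algebra_simps)
      also have "\<dots> \<le> 1 * norm (u - v) / 2" by (intro divide_right_mono mult_right_mono gK) auto
      finally show "dist (g - B u u) (g - B v v) \<le> 1/2 * dist u v" by (simp add: dist_norm)
    qed auto
    then obtain u where u: "norm u \<le> 2 * ?n" "u = g - B u u" by (metis mem_cball_0)
    have "norm (g - u) = norm (g - (g - B u u))" using u(2) by metis
    also have "\<dots> = norm (B u u)" by simp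
    also have "\<dots> \<le> (2 * ?n) * (2 * ?n) * K" by (intro Bb u(1))
    finally have gu: "norm (g - u) \<le> (2 * ?n) * (2 * ?n) * K" .
    have "u - (g - B g g) = (g - B u u) - (g - B g g)" using u(2) by metis
    also have "\<dots> = B (g - u) g + B u (g - u)" by (simp add: diff_left diff_right)
    finally have "norm (u - (g - B g g)) = norm (B (g - u) g + B u (g - u))" by (rule arg_cong)
    also have "\<dots> \<le> ((2 * ?n) * (2 * ?n) * K) * ?n * K + (2 * ?n) * ((2 * ?n) * (2 * ?n) * K) * K"
      by (intro order_trans[OF norm_triangle_ineq] add_mono Bb u(1) gu) auto
    also have "\<dots> = 12 * K\<^sup>2 * ?n ^ 3" by (simp add: power2_eq_square power3_eq_cube)
    finally show ?thesis using u(2) by blast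
  qed
  show thesis by (rule that[of "1 / (8 * K)" "12 * K\<^sup>2"]) (use K main in auto)
qed

section \<open>Distributions given by bounded Fourier coefficients\<close>

text \<open>The distribution \<open>\<Sum>k. c k * exp (\<i> k x)\<close>. Solutions are given in this form because
distributions defined by the same series agree as soon as their coefficient sequences do.\<close>

definition fourier_synth :: "(int \<Rightarrow> complex) \<Rightarrow> pdist" where
  "fourier_synth c = Abs_pdist (\<lambda>\<psi>. if \<psi> \<in> test_functions then \<Sum>\<^sub>\<infinity>k. c k * osc_int k \<psi> else 0)"

lemma bounded_coeffs_growth:
  fixes c :: "int \<Rightarrow> complex"
  assumes "\<And>k. norm (c k) \<le> M"
  shows "norm (c k) \<le> M * (1 + \<bar>of_int k\<bar>) ^ 0" "0 \<le> M"
  using assms order_trans[OF norm_ge_zero assms] by auto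

lemma pairing_synth:
  assumes "\<And>k. norm (c k) \<le> M" "\<psi> \<in> test_functions"
  shows "pairing (fourier_synth c) \<psi> = (\<Sum>\<^sub>\<infinity>k. c k * osc_int k \<psi>)"
  unfolding fourier_synth_def
  by (subst Abs_pdist_inverse)
     (use assms is_distribution_synthesis[OF bounded_coeffs_growth[of c M]] in auto)

lemma pdist_eqI:
  assumes "\<And>\<psi>. \<psi> \<in> test_functions \<Longrightarrow> pairing f \<psi> = pairing g \<psi>"
  shows "f = g"
proof -
  have "pairing h \<psi> = 0" if "\<psi> \<notin> test_functions" for h \<psi>
    using pairing[of h] that by (simp add: is_distribution_def)
  then have "pairing f = pairing g" using assms by (metis ext)
  then show ?thesis by (simp add: pairing_inject)
qed

lemma synth_summable:
  assumes "\<And>k. norm (c k) \<le> M" "\<psi> \<in> test_functions"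
  shows "(\<lambda>k. c k * osc_int k \<psi>) summable_on UNIV"
  by (rule abs_summable_summable[OF synthesis_abs_summable[OF bounded_coeffs_growth]])
     (use assms in auto)

lemma synth_diff:
  assumes "\<And>k. norm (c k) \<le> M" "\<And>k. norm (d k) \<le> M'"
  shows "fourier_synth c - fourier_synth d = fourier_synth (\<lambda>k. c k - d k)"
proof (rule pdist_eqI)
  fix \<psi> assume t: "\<psi> \<in> test_functions"
  have b: "norm (c k - d k) \<le> M + M'" for k
    using norm_triangle_ineq4[of "c k" "d k"] assms(1)[of k] assms(2)[of k] by linarith
  have "pairing (fourier_synth c - fourier_synth d) \<psi> = pairing (fourier_synth c) \<psi> - pairing (fourier_synth d) \<psi>"
    by (simp add: minus_pdist.rep_eq)
  also have "\<dots> = (\<Sum>\<^sub>\<infinity>k. c k * osc_int k \<psi> - d k * osc_int k \<psi>)"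
    unfolding pairing_synth[OF assms(1) t] pairing_synth[OF assms(2) t]
    using infsum_add[OF synth_summable[OF assms(1) t]
        summable_on_uminus[THEN iffD2, OF synth_summable[OF assms(2) t]]]
    by (simp add: infsum_uminus)
  also have "\<dots> = pairing (fourier_synth (\<lambda>k. c k - d k)) \<psi>"
    by (simp add: pairing_synth[OF b t] left_diff_distrib)
  finally show "pairing (fourier_synth c - fourier_synth d) \<psi> = \<dots>" .
qed

lemma synth_scaleR:
  assumes "\<And>k. norm (c k) \<le> M"
  shows "r *\<^sub>R fourier_synth c = fourier_synth (\<lambda>k. of_real r * c k)"
proof (rule pdist_eqI)
  fix \<psi> assume t: "\<psi> \<in> test_functions"
  have b: "norm (of_real r * c k) \<le> \<bar>r\<bar> * M" for k
    using mult_left_mono[OF assms[of k] abs_ge_zero[of r]] by (simp add: norm_mult)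
  show "pairing (r *\<^sub>R fourier_synth c) \<psi> = pairing (fourier_synth (\<lambda>k. of_real r * c k)) \<psi>"
    by (simp only: scaleR_pdist.rep_eq pairing_synth[OF assms t] pairing_synth[OF b t]
        infsum_cmult_right'[symmetric] mult.assoc)
qed

lemma fourier_coeff_synth:
  assumes "\<And>k. norm (c k) \<le> M"
  shows "fourier_coeff (fourier_synth c) k = c k"
proof -
  have t: "(\<lambda>x. cis (- (of_int k * x))) \<in> test_functions"
    using test_functions_cis[of "-k"] by simp
  have "pairing (fourier_synth c) (\<lambda>x. cis (- (of_int k * x)))
      = (\<Sum>\<^sub>\<infinity>j. c j * (if j = k then 2 * of_real pi else 0))"
    by (simp add: pairing_synth[OF assms t] osc_int_cis)
  also have "\<dots> = (\<Sum>\<^sub>\<infinity>j\<in>{k}. c j * (if j = k then 2 * of_real pi else 0))"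
    by (rule infsum_cong_neutral) auto
  finally show ?thesis by (simp add: fourier_coeff_def)
qed

lemma fourier_coeff_add: "fourier_coeff (f + g) k = fourier_coeff f k + fourier_coeff g k"
  by (simp add: fourier_coeff_def plus_pdist.rep_eq add_divide_distrib)

lemma fourier_coeff_diff: "fourier_coeff (f - g) k = fourier_coeff f k - fourier_coeff g k"
  by (simp add: fourier_coeff_def minus_pdist.rep_eq diff_divide_distrib)

lemma fourier_coeff_scaleR: "fourier_coeff (r *\<^sub>R f) k = of_real r * fourier_coeff f k"
  by (simp add: fourier_coeff_def scaleR_pdist.rep_eq)

lemma fourier_coeff_dist_deriv: "fourier_coeff (dist_deriv f) k = \<i> * of_int k * fourier_coeff f k"
proof -
  let ?e = "\<lambda>x. cis (- (of_int k * x)) :: complex"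
  have t: "?e \<in> test_functions"
    using test_functions_cis[of "-k"] by simp
  have "vderiv ?e = (\<lambda>x. (- \<i> * of_int k) * ?e x)"
    using vderiv_pow_cis[of 1 "- of_int k"] by (simp add: fun_eq_iff)
  moreover have "is_distribution (pairing f)" using pairing by auto
  ultimately have "pairing f (vderiv ?e) = - \<i> * of_int k * pairing f ?e"
    using t unfolding is_distribution_def by metis
  then show ?thesis using t by (simp add: fourier_coeff_def dist_deriv.rep_eq)
qed

lemma fourier_multiplier_eq_synth:
  "fourier_multiplier m f = fourier_synth (\<lambda>k. m k * fourier_coeff f k)"
  unfolding fourier_multiplier_def fourier_synth_def multiplier_functional_def[abs_def] ..

text \<open>After pairing with a test function \<open>\<psi>\<close> the series is dominated by a multiple of \<open>\<Sum>k. (1 + \<bar>k\<bar>)\<^bsup>-2\<^esup>\<close>,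
because the Fourier coefficients of \<open>\<psi>\<close> decay; so summation and integration commute.\<close>

lemma has_weak_integral_synth:
  assumes c: "\<And>k. continuous_on {a..b} (\<lambda>t. c t k)"
    and M: "\<And>k t. t \<in> {a..b} \<Longrightarrow> norm (c t k) \<le> M"
    and ab: "a \<le> b"
    and F: "\<And>t. t \<in> {a..b} \<Longrightarrow> F t = fourier_synth (c t)"
  shows "has_weak_integral F (fourier_synth (\<lambda>k. integral {a..b} (\<lambda>t. c t k))) a b"
  unfolding has_weak_integral_def
proof
  fix \<psi> assume t: "\<psi> \<in> test_functions"
  let ?h = "\<lambda>t. \<Sum>\<^sub>\<infinity>k. c t k * osc_int k \<psi>"
  have M0: "0 \<le> M" using M[of a 0] ab norm_ge_zero order_trans by (metis atLeastAtMost_iff order_refl)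
  define K where "K = M * (2 ^ 2 * (4 * pi)) * Ck_norm (0 + 2) \<psi>"
  have bnd: "norm (c \<tau> k * osc_int k \<psi>) \<le> K * (1 / (1 + \<bar>of_int k\<bar>)\<^sup>2)" if "\<tau> \<in> {a..b}" for k \<tau>
    using synthesis_bound[OF bounded_coeffs_growth[of "c \<tau>" M], of \<psi> k] M[OF that] t
    by (simp add: K_def)
  have sm: "(\<lambda>k::int. K * (1 / (1 + \<bar>of_int k\<bar>)\<^sup>2)) summable_on UNIV"
    by (intro summable_on_cmult_right inverse_square_int_summable)
  have cc: "continuous_on {a..b} (\<lambda>\<tau>. c \<tau> k * osc_int k \<psi>)" for k
    by (intro continuous_intros c)
  have "continuous_on {a..b} ?h" by (rule continuous_on_infsum[OF cc bnd sm])
  then have "has_bochner_integral (lebesgue_on {a..b}) ?h (integral {a..b} ?h)"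
    by (rule has_bochner_integral_continuous_interval)
  also have "?this \<longleftrightarrow>
      has_bochner_integral (lebesgue_on {a..b}) (\<lambda>t. pairing (F t) \<psi>) (integral {a..b} ?h)"
    by (rule has_bochner_integral_cong) (auto simp: F pairing_synth[OF M t])
  also have "integral {a..b} ?h = (\<Sum>\<^sub>\<infinity>k. integral {a..b} (\<lambda>\<tau>. c \<tau> k * osc_int k \<psi>))"
    by (rule integral_infsum[OF cc bnd sm])
  also have "\<dots> = (\<Sum>\<^sub>\<infinity>k. integral {a..b} (\<lambda>\<tau>. c \<tau> k) * osc_int k \<psi>)"
    by simp
  also have "\<dots> = pairing (fourier_synth (\<lambda>k. integral {a..b} (\<lambda>t. c t k))) \<psi>"
  proof (rule pairing_synth[OF _ t, symmetric])
    fix k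
    show "norm (integral {a..b} (\<lambda>t. c t k)) \<le> M * (b - a)"
      by (rule integral_bound) (use ab c M in auto)
  qed
  finally show "has_bochner_integral (lebesgue_on {a..b}) (\<lambda>t. pairing (F t) \<psi>)
      (pairing (fourier_synth (\<lambda>k. integral {a..b} (\<lambda>t. c t k))) \<psi>)" .
qed

section \<open>Sobolev norms\<close>

abbreviation sobolev_term :: "real \<Rightarrow> pdist \<Rightarrow> int \<Rightarrow> real" where
  "sobolev_term s f k \<equiv> ((1 + (of_int k)\<^sup>2) powr (s / 2) * norm (fourier_coeff f k))\<^sup>2"

lemma sobolev_add:
  assumes "f \<in> sobolev s" "g \<in> sobolev s"
  shows "f + g \<in> sobolev s"
proof -
  have sq: "(a + b)\<^sup>2 \<le> 2 * a\<^sup>2 + 2 * b\<^sup>2" for a b :: real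
    using zero_le_power2[of "a - b"] by (simp add: power2_eq_square algebra_simps)
  have "sobolev_term s (f + g) k \<le> 2 * sobolev_term s f k + 2 * sobolev_term s g k" for k
  proof -
    let ?w = "(1 + (of_int k)\<^sup>2) powr (s / 2) :: real"
    have "sobolev_term s (f + g) k \<le> (?w * norm (fourier_coeff f k) + ?w * norm (fourier_coeff g k))\<^sup>2"
      unfolding fourier_coeff_add distrib_left[symmetric]
      by (intro power_mono mult_left_mono norm_triangle_ineq) auto
    then show ?thesis using sq order_trans by blast
  qed
  moreover have "(\<lambda>k. 2 * sobolev_term s f k + 2 * sobolev_term s g k) summable_on UNIV"
    using assms by (intro summable_on_add summable_on_cmult_right) (auto simp: sobolev_def)
  ultimately show ?thesis
    unfolding sobolev_def by (auto intro: summable_on_comparison_test)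
qed

lemma sobolev_term_scaleR: "sobolev_term s (r *\<^sub>R f) k = r\<^sup>2 * sobolev_term s f k"
  by (simp add: fourier_coeff_scaleR norm_mult power_mult_distrib)

lemma sobolev_scaleR:
  assumes "f \<in> sobolev s"
  shows "r *\<^sub>R f \<in> sobolev s"
  using assms unfolding sobolev_def mem_Collect_eq sobolev_term_scaleR
  by (rule summable_on_cmult_right)

lemma sobolev_norm_scaleR: "sobolev_norm s (r *\<^sub>R f) = \<bar>r\<bar> * sobolev_norm s f"
  unfolding sobolev_norm_def sobolev_term_scaleR infsum_cmult_right' real_sqrt_mult
  by simp

lemma sobolev_diff:
  assumes "f \<in> sobolev s" "g \<in> sobolev s"
  shows "f - g \<in> sobolev s"
  using sobolev_add[OF assms(1) sobolev_scaleR[OF assms(2), of "-1"]] by simp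

lemma sobolev_norm_nonneg: "0 \<le> sobolev_norm s f"
  unfolding sobolev_norm_def by (intro mult_nonneg_nonneg real_sqrt_ge_zero infsum_nonneg) auto

lemma fourier_coeff_le_sobolev_norm:
  assumes "f \<in> sobolev s"
  shows "norm (fourier_coeff f k) \<le> (1 + (of_int k)\<^sup>2) powr (- s / 2) * sobolev_norm s f"
proof -
  let ?w = "(1 + (of_int k)\<^sup>2) powr (s / 2) :: real"
  have "sobolev_term s f k \<le> (\<Sum>\<^sub>\<infinity>k. sobolev_term s f k)"
    using infsum_mono2[of "sobolev_term s f" "{k}" UNIV] assms by (simp add: sobolev_def)
  then have "?w * norm (fourier_coeff f k) \<le> sqrt (\<Sum>\<^sub>\<infinity>k. sobolev_term s f k)"
    by (rule real_le_rsqrt)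
  also have "\<dots> \<le> sobolev_norm s f"
  proof -
    have "1 \<le> sqrt (2 * pi)" using pi_gt3 by simp
    then have "1 * sqrt (\<Sum>\<^sub>\<infinity>k. sobolev_term s f k) \<le> sobolev_norm s f"
      unfolding sobolev_norm_def by (intro mult_right_mono real_sqrt_ge_zero infsum_nonneg) auto
    then show ?thesis by simp
  qed
  finally have "?w * norm (fourier_coeff f k) \<le> sobolev_norm s f" .
  then have "(1 + (of_int k)\<^sup>2) powr (- s / 2) * (?w * norm (fourier_coeff f k))
      \<le> (1 + (of_int k)\<^sup>2) powr (- s / 2) * sobolev_norm s f"
    by (intro mult_left_mono) auto
  moreover have "(1 + (of_int k)\<^sup>2) powr (- s / 2) * ?w = (1::real)"
    by (subst powr_add[symmetric]) (auto simp: add_nonneg_eq_0_iff)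
  ultimately show ?thesis by (simp add: mult.assoc[symmetric])
qed

text \<open>The choice of exponent \<open>2\<close> makes \<open>1 / weight\<close> summable, whence the stability of this decay under convolution, and makes
distributions with coefficients \<open>O(1 / weight k)\<close> square integrable, hence elements of every \<open>H\<^sup>s\<close> with
\<open>s \<le> 0\<close>.\<close>

definition weight :: "int \<Rightarrow> real" where
  "weight k = (1 + \<bar>of_int k\<bar>)\<^sup>2"

lemma weight_ge_1: "1 \<le> weight k"
  by (simp add: weight_def)

lemma weight_pos: "0 < weight k"
  using weight_ge_1[of k] by linarith

lemma sobolev_term_le_weight:
  assumes "s \<le> 0" "norm (fourier_coeff f k) \<le> M / weight k"
  shows "sobolev_term s f k \<le> M\<^sup>2 * (1 / weight k)"
proof -
  have "(1 + (of_int k)\<^sup>2) powr (s / 2) \<le> (1 :: real)"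
    using powr_mono[of "s/2" 0 "1 + (of_int k)\<^sup>2 :: real"] assms(1) by (simp add: add_nonneg_eq_0_iff)
  then have "sobolev_term s f k \<le> (1 * (M / weight k))\<^sup>2"
    by (intro power_mono mult_mono assms(2)) auto
  also have "\<dots> = M\<^sup>2 * (1 / weight k) * (1 / weight k)" by (simp add: power2_eq_square)
  also have "\<dots> \<le> M\<^sup>2 * (1 / weight k) * 1"
    using weight_ge_1[of k] weight_pos[of k] by (intro mult_left_mono) auto
  finally show ?thesis by simp
qed

lemma weight_summable: "(\<lambda>k. 1 / weight k) summable_on UNIV"
  using inverse_square_int_summable by (simp add: weight_def)

lemma sobolev_of_decay:
  assumes "s \<le> 0" "\<And>k. norm (fourier_coeff f k) \<le> M / weight k"
  shows "f \<in> sobolev s"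
  unfolding sobolev_def mem_Collect_eq
  by (rule summable_on_comparison_test[OF summable_on_cmult_right[OF weight_summable, of "M\<^sup>2"]])
     (use sobolev_term_le_weight[OF assms] in auto)

text \<open>The uniform bound by a summable sequence turns continuity of each coefficient into continuity
in norm.\<close>

lemma sobolev_norm_continuous_of_decay:
  fixes u :: "real \<Rightarrow> pdist"
  assumes s: "s \<le> 0"
    and M: "\<And>k t. t \<in> A \<Longrightarrow> norm (fourier_coeff (u t) k) \<le> M / weight k"
    and c: "\<And>k. continuous_on A (\<lambda>t. fourier_coeff (u t) k)"
    and t: "t \<in> A"
  shows "((\<lambda>t'. sobolev_norm s (u t' - u t)) \<longlongrightarrow> 0) (at t within A)"
proof -
  have "continuous_on A (\<lambda>t'. \<Sum>\<^sub>\<infinity>k. sobolev_term s (u t' - u t) k)"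
  proof (rule continuous_on_infsum)
    fix k
    show "continuous_on A (\<lambda>t'. sobolev_term s (u t' - u t) k)"
      by (auto simp: fourier_coeff_diff intro!: continuous_intros c)
    fix t' assume "t' \<in> A"
    then have "norm (fourier_coeff (u t' - u t) k) \<le> (2 * M) / weight k"
      using norm_triangle_ineq4[of "fourier_coeff (u t') k" "fourier_coeff (u t) k"]
        M[OF t, of k] M[of t' k] by (simp add: fourier_coeff_diff)
    from sobolev_term_le_weight[OF s this]
    show "norm (sobolev_term s (u t' - u t) k) \<le> (2 * M)\<^sup>2 * (1 / weight k)" by simp
  qed (intro summable_on_cmult_right weight_summable)
  then have "continuous_on A (\<lambda>t'. sobolev_norm s (u t' - u t))"
    unfolding sobolev_norm_def by (intro continuous_intros)
  moreover have "sobolev_norm s (u t - u t) = 0"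
    unfolding sobolev_norm_def fourier_coeff_diff by simp
  ultimately show ?thesis using t by (auto simp: continuous_on_def)
qed

lemma weight_decay_bounded:
  assumes "norm (c k) \<le> M / weight k"
  shows "norm (c k) \<le> M"
proof -
  have "0 \<le> M / weight k" using assms norm_ge_zero order_trans by blast
  then have "0 \<le> M" using weight_pos[of k] by (simp add: zero_le_divide_iff)
  then have "M / weight k \<le> M / 1" using weight_ge_1[of k] by (intro divide_left_mono) auto
  then show ?thesis using assms by simp
qed

lemma weight_decay_derivative_bounded:
  assumes "norm (c k) \<le> M / weight k"
  shows "norm (\<i> * of_int k / 2 * c k) \<le> M"
proof -
  have "\<bar>of_int k\<bar> / 2 \<le> (1 + \<bar>of_int k\<bar>) * (1 + \<bar>of_int k :: real\<bar>)"
    by (simp add: algebra_simps add_nonneg_nonneg)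
  then have "\<bar>of_int k\<bar> / 2 \<le> weight k" by (simp add: weight_def power2_eq_square)
  then have "norm (\<i> * of_int k / 2 * c k) \<le> weight k * (M / weight k)"
    unfolding norm_mult norm_divide using weight_pos[of k] by (intro mult_mono assms) auto
  then show ?thesis using weight_pos[of k] by simp
qed

lemma fourier_coeff_synth_of_decay:
  assumes "\<And>k. norm (c k) \<le> M / weight k"
  shows "fourier_coeff (fourier_synth c) k = c k"
  by (rule fourier_coeff_synth[OF weight_decay_bounded[OF assms]])

section \<open>Convolution of decaying coefficients\<close>

definition conv :: "(int \<Rightarrow> complex) \<Rightarrow> (int \<Rightarrow> complex) \<Rightarrow> int \<Rightarrow> complex" where
  "conv c d k = (\<Sum>\<^sub>\<infinity>j. c j * d (k - j))"

definition weight_sum :: real where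
  "weight_sum = (\<Sum>\<^sub>\<infinity>k. 1 / weight k)"

lemma weight_sum_nonneg: "0 \<le> weight_sum"
  unfolding weight_sum_def using weight_pos by (intro infsum_nonneg) (auto intro: less_imp_le)

lemma weight_shift_summable: "(\<lambda>j. 1 / weight (k - j)) summable_on UNIV"
  and infsum_weight_shift: "(\<Sum>\<^sub>\<infinity>j. 1 / weight (k - j)) = weight_sum"
proof -
  have b: "bij_betw (\<lambda>j. k - j) UNIV (UNIV :: int set)"
    by (rule bij_betwI[where g = "\<lambda>j. k - j"]) auto
  show "(\<lambda>j. 1 / weight (k - j)) summable_on UNIV"
    using summable_on_reindex_bij_betw[OF b, of "\<lambda>j. 1 / weight j"] weight_summable by simp
  show "(\<Sum>\<^sub>\<infinity>j. 1 / weight (k - j)) = weight_sum"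
    using infsum_reindex_bij_betw[OF b, of "\<lambda>j. 1 / weight j"] by (simp add: weight_sum_def)
qed

text \<open>A form of Peetre's inequality: one of \<open>j\<close> and \<open>k - j\<close> has at least half the size of \<open>k\<close>, so one of the two factors
supplies the decay in \<open>k\<close> and the other one remains for the summation over \<open>j\<close>.\<close>

lemma weight_convolution:
  "1 / (weight j * weight (k - j)) \<le> 2 / weight k * (1 / weight j + 1 / weight (k - j))"
proof -
  let ?a = "1 + \<bar>of_int j\<bar> :: real" and ?b = "1 + \<bar>of_int (k - j)\<bar> :: real"
  have "\<bar>of_int k\<bar> \<le> \<bar>of_int j\<bar> + (\<bar>of_int (k - j)\<bar> :: real)" by simp
  then have "weight k \<le> (?a + ?b)\<^sup>2" unfolding weight_def by (intro power_mono) auto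
  also have "\<dots> \<le> 2 * (?a\<^sup>2 + ?b\<^sup>2)"
    using zero_le_power2[of "?a - ?b"] by (simp add: power2_eq_square algebra_simps)
  finally have "weight k \<le> 2 * (weight j + weight (k - j))" by (simp add: weight_def)
  moreover have "2 / weight k * (1 / weight j + 1 / weight (k - j))
      = (2 * (weight j + weight (k - j)) / weight k) / (weight j * weight (k - j))"
    using weight_pos[of k] weight_pos[of j] weight_pos[of "k - j"] by (simp add: field_simps)
  ultimately show ?thesis
    using weight_pos[of k] weight_pos[of j] weight_pos[of "k - j"]
    by (simp only:) (intro divide_right_mono, auto)
qed

lemma
  assumes c: "\<And>j. norm (c j) \<le> M / weight j" and d: "\<And>j. norm (d j) \<le> N / weight j"
  shows conv_term_bound:
      "norm (c j * d (k - j)) \<le> 2 * M * N / weight k * (1 / weight j + 1 / weight (k - j))"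
    and conv_majorant_summable:
      "(\<lambda>j. 2 * M * N / weight k * (1 / weight j + 1 / weight (k - j))) summable_on UNIV"
    and conv_summable: "(\<lambda>j. c j * d (k - j)) summable_on UNIV"
    and norm_conv_le: "norm (conv c d k) \<le> 4 * weight_sum * M * N / weight k"
proof -
  have MN: "0 \<le> M" "0 \<le> N"
    using order_trans[OF norm_ge_zero c[of 0]] order_trans[OF norm_ge_zero d[of 0]]
    by (simp_all add: weight_def)
  show b: "norm (c j * d (k - j)) \<le> 2 * M * N / weight k * (1 / weight j + 1 / weight (k - j))" for j
  proof -
    have "norm (c j * d (k - j)) \<le> (M / weight j) * (N / weight (k - j))"
      unfolding norm_mult using c d MN weight_pos[of j] by (intro mult_mono) auto
    also have "\<dots> = M * N * (1 / (weight j * weight (k - j)))" by simp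
    also have "\<dots> \<le> M * N * (2 / weight k * (1 / weight j + 1 / weight (k - j)))"
      using MN by (intro mult_left_mono weight_convolution) auto
    finally show ?thesis by (simp add: mult_ac)
  qed
  show s: "(\<lambda>j. 2 * M * N / weight k * (1 / weight j + 1 / weight (k - j))) summable_on UNIV"
    by (intro summable_on_cmult_right summable_on_add weight_summable weight_shift_summable)
  have a: "(\<lambda>j. norm (c j * d (k - j))) summable_on UNIV"
    by (rule summable_on_comparison_test[OF s b]) auto
  then show "(\<lambda>j. c j * d (k - j)) summable_on UNIV" by (rule abs_summable_summable)
  have "norm (conv c d k) \<le> (\<Sum>\<^sub>\<infinity>j. norm (c j * d (k - j)))"
    unfolding conv_def by (rule norm_infsum_bound[OF a])
  also have "\<dots> \<le> (\<Sum>\<^sub>\<infinity>j. 2 * M * N / weight k * (1 / weight j + 1 / weight (k - j)))"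
    by (rule infsum_mono[OF a s b])
  also have "\<dots> = 2 * M * N / weight k * (weight_sum + weight_sum)"
    by (simp only: infsum_cmult_right' infsum_add[OF weight_summable weight_shift_summable]
        infsum_weight_shift weight_sum_def[symmetric])
  finally show "norm (conv c d k) \<le> 4 * weight_sum * M * N / weight k" by (simp add: mult_ac)
qed

section \<open>Trajectories of Fourier coefficients\<close>

lemma continuous_on_int_times:
  fixes f :: "int \<times> real \<Rightarrow> 'b::topological_space"
  assumes "\<And>k. continuous_on UNIV (\<lambda>t. f (k, t))"
  shows "continuous_on UNIV f"
proof -
  have "open (f -` U)" if "open U" for U
  proof -
    have "f -` U = (\<Union>k. {k} \<times> ((\<lambda>t. f (k, t)) -` U))" by auto
    also have "open \<dots>"
      using assms \<open>open U\<close> by (intro open_UN ballI open_Times open_discrete open_vimage)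
    finally show ?thesis .
  qed
  then show ?thesis by (simp add: continuous_on_open_vimage)
qed

text \<open>The Banach space of the contraction argument. An element \<open>f\<close> stands for the family of coefficients
\<open>f (k, t) / weight k\<close>, so the supremum norm of \<open>f\<close> is the weighted norm of the coefficients.\<close>

type_synonym trajectory = "(int \<times> real) \<Rightarrow>\<^sub>C complex"

definition traj_coeff :: "trajectory \<Rightarrow> real \<Rightarrow> int \<Rightarrow> complex" where
  "traj_coeff f t k = apply_bcontfun f (k, t) / of_real (weight k)"

lemma norm_traj_coeff_le: "norm (traj_coeff f t k) \<le> norm f / weight k"
  unfolding traj_coeff_def norm_divide using weight_pos[of k] norm_bounded[of f "(k, t)"]
  by (simp add: divide_right_mono)

lemma continuous_on_traj_coeff: "continuous_on A (\<lambda>t. traj_coeff f t k)"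
proof -
  have "continuous_on A (\<lambda>t. apply_bcontfun f (k, t))"
    by (rule continuous_on_compose2[OF continuous_on_apply_bcontfun[of UNIV]])
       (auto intro!: continuous_intros)
  then show ?thesis unfolding traj_coeff_def using weight_pos[of k]
    by (intro continuous_intros) auto
qed

lemma traj_coeff_add: "traj_coeff (f + g) t k = traj_coeff f t k + traj_coeff g t k"
  and traj_coeff_diff: "traj_coeff (f - g) t k = traj_coeff f t k - traj_coeff g t k"
  and traj_coeff_scaleR: "traj_coeff (r *\<^sub>R f) t k = of_real r * traj_coeff f t k"
  by (simp_all add: traj_coeff_def add_divide_distrib diff_divide_distrib scaleR_conv_of_real)

text \<open>Inverse of \<^const>\<open>traj_coeff\<close> on coefficient families that are continuous in time and \<open>O(1 / weight k)\<close>.\<close>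

definition weighted :: "(real \<Rightarrow> int \<Rightarrow> complex) \<Rightarrow> trajectory" where
  "weighted c = Bcontfun (\<lambda>(k, t). of_real (weight k) * c t k)"

lemma
  assumes "\<And>k. continuous_on UNIV (\<lambda>t. c t k)" "\<And>t k. norm (c t k) \<le> M / weight k"
  shows traj_coeff_weighted: "traj_coeff (weighted c) t k = c t k"
    and norm_weighted_le: "norm (weighted c) \<le> M"
proof -
  have b: "norm (of_real (weight k) * c t k) \<le> M" for k t
    using mult_left_mono[OF assms(2)[of t k], of "weight k"] weight_pos[of k] by (simp add: norm_mult)
  have "(\<lambda>(k, t). of_real (weight k) * c t k) \<in> bcontfun"
    by (rule bcontfun_normI[where b = M])
       (use b in \<open>auto intro!: continuous_on_int_times continuous_intros assms(1)\<close>)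
  then have a: "apply_bcontfun (weighted c) = (\<lambda>(k, t). of_real (weight k) * c t k)"
    unfolding weighted_def by (rule Bcontfun_inverse)
  then show "traj_coeff (weighted c) t k = c t k"
    using weight_pos[of k] by (simp add: traj_coeff_def)
  show "norm (weighted c) \<le> M"
    by (rule norm_bound) (use a b in auto)
qed

lemma trajectory_eqI:
  assumes "\<And>t k. traj_coeff f t k = traj_coeff g t k"
  shows "f = g"
proof (rule bcontfun_eqI)
  fix x :: "int \<times> real"
  show "apply_bcontfun f x = apply_bcontfun g x"
    using assms[of "snd x" "fst x"] weight_pos[of "fst x"] by (simp add: traj_coeff_def)
qed

abbreviation traj_conv :: "trajectory \<Rightarrow> trajectory \<Rightarrow> real \<Rightarrow> int \<Rightarrow> complex" where
  "traj_conv f g t k \<equiv> conv (traj_coeff f t) (traj_coeff g t) k"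

lemma continuous_on_traj_conv: "continuous_on A (\<lambda>t. traj_conv f g t k)"
  unfolding conv_def
  by (rule continuous_on_infsum[OF _ conv_term_bound[OF norm_traj_coeff_le norm_traj_coeff_le]
        conv_majorant_summable[OF norm_traj_coeff_le norm_traj_coeff_le]])
     (intro continuous_intros continuous_on_traj_coeff)

lemma traj_conv_add_left: "traj_conv (f + f') g t k = traj_conv f g t k + traj_conv f' g t k"
  and traj_conv_add_right: "traj_conv f (g + g') t k = traj_conv f g t k + traj_conv f g' t k"
  unfolding conv_def traj_coeff_add distrib_left distrib_right
  by (intro infsum_add conv_summable[OF norm_traj_coeff_le norm_traj_coeff_le])+

lemma traj_conv_scaleR_left: "traj_conv (r *\<^sub>R f) g t k = of_real r * traj_conv f g t k"
  and traj_conv_scaleR_right: "traj_conv f (r *\<^sub>R g) t k = of_real r * traj_conv f g t k"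
  unfolding conv_def traj_coeff_scaleR by (simp_all only: infsum_cmult_right'[symmetric] mult_ac)

section \<open>The Duhamel operator\<close>

locale chen_lee =
  fixes \<beta> \<eta> T :: real
  assumes eta_pos: "0 < \<eta>" and T_pos: "0 < T"
begin

definition symbol :: "int \<Rightarrow> complex" where
  "symbol k = \<i> * of_real (chen_lee_q \<beta> k) - of_real (chen_lee_p \<eta> k)"

definition propagator :: "int \<Rightarrow> real \<Rightarrow> complex" where
  "propagator k t = exp (symbol k * of_real t)"

lemma propagator_eq: "exp (\<i> * of_real (chen_lee_q \<beta> k * t) - of_real (chen_lee_p \<eta> k * t)) = propagator k t"
  by (simp add: propagator_def symbol_def left_diff_distrib mult.assoc)

lemma propagator_add: "propagator k (a + b) = propagator k a * propagator k b"
  by (simp add: propagator_def distrib_left exp_add)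

lemma norm_propagator: "norm (propagator k t) = exp (- chen_lee_p \<eta> k * t)"
  by (simp add: propagator_def symbol_def norm_exp)

lemma continuous_on_propagator: "continuous_on A h \<Longrightarrow> continuous_on A (\<lambda>t. propagator k (h t))"
  unfolding propagator_def by (intro continuous_intros)

lemma p_eq: "chen_lee_p \<eta> k = \<eta> * (\<bar>of_int k\<bar> * (\<bar>of_int k\<bar> - 1))"
  by (simp add: chen_lee_p_def power2_eq_square algebra_simps flip: abs_mult)

lemma p_nonneg: "0 \<le> chen_lee_p \<eta> k"
proof (cases "k = 0")
  case False
  then have "1 \<le> \<bar>k\<bar>" by simp
  then have "1 \<le> \<bar>of_int k :: real\<bar>" by (metis of_int_1_le_iff of_int_abs)
  then show ?thesis unfolding p_eq using eta_pos by simp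
qed (simp add: p_eq)

lemma norm_propagator_le_1: "0 \<le> t \<Longrightarrow> norm (propagator k t) \<le> 1"
  using p_nonneg[of k] by (simp add: norm_propagator)

text \<open>Dissipation gains the derivative that the nonlinearity loses: for \<open>\<bar>k\<bar> \<ge> 2\<close> the integral is at most
\<open>1 / p(k)\<close> and \<open>p(k) \<ge> \<eta> \<bar>k\<bar>\<close>. The frequencies \<open>\<bar>k\<bar> \<le> 1\<close> are not damped and contribute the length of the
time interval.\<close>

lemma smoothing_integral:
  assumes "0 \<le> t" "t \<le> T"
  shows "\<bar>of_int k\<bar> * integral {0..t} (\<lambda>\<tau>. norm (propagator k (t - \<tau>))) \<le> T + 1 / \<eta>"
proof (cases "\<bar>k\<bar> \<le> 1")
  case True
  have "integral {0..t} (\<lambda>\<tau>. norm (propagator k (t - \<tau>))) \<le> integral {0..t} (\<lambda>\<tau>. 1)"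
    by (intro integral_le integrable_continuous_interval continuous_intros continuous_on_propagator)
       (auto intro: norm_propagator_le_1)
  then have "integral {0..t} (\<lambda>\<tau>. norm (propagator k (t - \<tau>))) \<le> T" using assms by simp
  moreover have "\<bar>of_int k\<bar> \<le> (1::real)" using True by (metis of_int_abs of_int_le_1_iff)
  moreover have "0 \<le> integral {0..t} (\<lambda>\<tau>. norm (propagator k (t - \<tau>)))"
    by (rule integral_nonneg)
       (auto intro!: integrable_continuous_interval continuous_intros continuous_on_propagator)
  ultimately have "\<bar>of_int k\<bar> * integral {0..t} (\<lambda>\<tau>. norm (propagator k (t - \<tau>))) \<le> 1 * T"
    by (intro mult_mono) auto
  then show ?thesis using eta_pos by (simp add: add_increasing2)
next
  case False
  let ?p = "chen_lee_p \<eta> k" and ?k = "\<bar>of_int k\<bar> :: real"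
  have "2 \<le> \<bar>k\<bar>" using False by simp
  then have k: "2 \<le> ?k" by (metis of_int_abs of_int_le_iff of_int_numeral)
  have p: "\<eta> * ?k \<le> ?p"
    unfolding p_eq using k eta_pos by (intro mult_left_mono) (auto simp: mult_le_cancel_left1)
  moreover have "0 < \<eta> * ?k" using eta_pos k by simp
  ultimately have p0: "0 < ?p" by linarith
  have "((\<lambda>\<tau>. norm (propagator k (t - \<tau>))) has_integral (exp (- ?p * (t - t)) / ?p - exp (- ?p * (t - 0)) / ?p)) {0..t}"
    unfolding norm_propagator using assms p0
    by (intro fundamental_theorem_of_calculus)
       (auto intro!: derivative_eq_intros simp: has_real_derivative_iff_has_vector_derivative[symmetric])
  then have "integral {0..t} (\<lambda>\<tau>. norm (propagator k (t - \<tau>))) = 1 / ?p - exp (- ?p * t) / ?p"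
    by (simp add: integral_unique)
  also have "\<dots> \<le> 1 / ?p" using p0 by simp
  also have "\<dots> \<le> 1 / (\<eta> * ?k)" using p \<open>0 < \<eta> * ?k\<close> by (intro divide_left_mono) auto
  finally have "?k * integral {0..t} (\<lambda>\<tau>. norm (propagator k (t - \<tau>))) \<le> ?k * (1 / (\<eta> * ?k))"
    by (intro mult_left_mono) auto
  also have "\<dots> = 1 / \<eta>" using k by simp
  finally show ?thesis using T_pos by simp
qed

text \<open>Trajectories are functions on the whole real line; outside \<open>{0..T}\<close> they are continued by
their values at the end points.\<close>

definition clamp_time :: "real \<Rightarrow> real" where
  "clamp_time t = max 0 (min T t)"

lemma clamp_time_id [simp]: "t \<in> {0..T} \<Longrightarrow> clamp_time t = t"
  and clamp_time_mem: "0 \<le> clamp_time t" "clamp_time t \<le> T"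
  using T_pos by (auto simp: clamp_time_def)

lemma continuous_on_clamp_time: "continuous_on A clamp_time"
  unfolding clamp_time_def by (intro continuous_intros)

definition duhamel_coeff :: "trajectory \<Rightarrow> trajectory \<Rightarrow> real \<Rightarrow> int \<Rightarrow> complex" where
  "duhamel_coeff f g t k =
     integral {0..clamp_time t} (\<lambda>\<tau>. propagator k (clamp_time t - \<tau>) * (\<i> * of_int k / 2 * traj_conv f g \<tau> k))"

lemma continuous_on_duhamel_integrand:
  "continuous_on A (\<lambda>\<tau>. propagator k (t - \<tau>) * (\<i> * of_int k / 2 * traj_conv f g \<tau> k))"
  by (intro continuous_intros continuous_on_propagator continuous_on_traj_conv) auto

lemma duhamel_integrable:
  "(\<lambda>\<tau>. propagator k (t - \<tau>) * (\<i> * of_int k / 2 * traj_conv f g \<tau> k)) integrable_on {a..b}"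
  by (intro integrable_continuous_interval continuous_on_duhamel_integrand)

lemma continuous_on_duhamel_coeff: "continuous_on UNIV (\<lambda>t. duhamel_coeff f g t k)"
proof -
  \<comment> \<open>Factoring the propagator leaves an indefinite integral of a function that does not depend on \<open>t\<close>.\<close>
  let ?h = "\<lambda>\<tau>. propagator k (0 - \<tau>) * (\<i> * of_int k / 2 * traj_conv f g \<tau> k)"
  have eq: "duhamel_coeff f g t k = propagator k (clamp_time t) * integral {0..clamp_time t} ?h" for t
  proof -
    have "propagator k (clamp_time t - \<tau>) = propagator k (clamp_time t) * propagator k (0 - \<tau>)" for \<tau>
      using propagator_add[of k "clamp_time t" "0 - \<tau>"] by simp
    then show ?thesis unfolding duhamel_coeff_def by (simp add: mult.assoc)
  qed
  have "continuous_on UNIV (\<lambda>t. integral {0..clamp_time t} ?h)"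
    by (rule continuous_on_compose2[OF indefinite_integral_continuous_1[OF duhamel_integrable]
          continuous_on_clamp_time])
       (use clamp_time_mem in auto)
  then show ?thesis
    unfolding eq by (intro continuous_intros continuous_on_propagator continuous_on_clamp_time)
qed

definition duhamel_const :: real where
  "duhamel_const = 2 * weight_sum * (T + 1 / \<eta>)"

lemma norm_duhamel_coeff_le:
  "norm (duhamel_coeff f g t k) \<le> duhamel_const * norm f * norm g / weight k"
proof -
  let ?C = "4 * weight_sum * norm f * norm g / weight k"
  have C: "0 \<le> ?C" using weight_sum_nonneg weight_pos[of k] by (simp add: less_imp_le)
  have "norm (duhamel_coeff f g t k)
      \<le> integral {0..clamp_time t} (\<lambda>\<tau>. norm (propagator k (clamp_time t - \<tau>)) * (\<bar>of_int k\<bar> / 2 * ?C))"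
    unfolding duhamel_coeff_def
  proof (rule integral_norm_bound_integral[OF duhamel_integrable])
    show "(\<lambda>\<tau>. norm (propagator k (clamp_time t - \<tau>)) * (\<bar>of_int k\<bar> / 2 * ?C)) integrable_on {0..clamp_time t}"
      by (intro integrable_continuous_interval continuous_intros continuous_on_propagator)
    fix \<tau>
    have "norm (traj_conv f g \<tau> k) \<le> ?C" by (intro norm_conv_le norm_traj_coeff_le)
    then show "norm (propagator k (clamp_time t - \<tau>) * (\<i> * of_int k / 2 * traj_conv f g \<tau> k))
        \<le> norm (propagator k (clamp_time t - \<tau>)) * (\<bar>of_int k\<bar> / 2 * ?C)"
      unfolding norm_mult norm_divide by (intro mult_mono) auto
  qed
  also have "\<dots> = (\<bar>of_int k\<bar> * integral {0..clamp_time t} (\<lambda>\<tau>. norm (propagator k (clamp_time t - \<tau>)))) * (?C / 2)"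
    by simp
  also have "\<dots> \<le> (T + 1 / \<eta>) * (?C / 2)"
    using C by (intro mult_right_mono smoothing_integral clamp_time_mem) auto
  also have "\<dots> = duhamel_const * norm f * norm g / weight k" by (simp add: duhamel_const_def)
  finally show ?thesis .
qed

definition duhamel :: "trajectory \<Rightarrow> trajectory \<Rightarrow> trajectory" where
  "duhamel f g = weighted (duhamel_coeff f g)"

lemma traj_coeff_duhamel: "traj_coeff (duhamel f g) t k = duhamel_coeff f g t k"
  unfolding duhamel_def
  by (rule traj_coeff_weighted[OF continuous_on_duhamel_coeff norm_duhamel_coeff_le])

lemma bounded_bilinear_duhamel: "bounded_bilinear duhamel"
proof
  fix f f' g g' :: trajectory and r :: real
  show "duhamel (f + f') g = duhamel f g + duhamel f' g"
    by (rule trajectory_eqI)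
       (simp only: traj_coeff_duhamel traj_coeff_add duhamel_coeff_def traj_conv_add_left distrib_left
          integral_add[OF duhamel_integrable duhamel_integrable])
  show "duhamel f (g + g') = duhamel f g + duhamel f g'"
    by (rule trajectory_eqI)
       (simp only: traj_coeff_duhamel traj_coeff_add duhamel_coeff_def traj_conv_add_right distrib_left
          integral_add[OF duhamel_integrable duhamel_integrable])
  show "duhamel (r *\<^sub>R f) g = r *\<^sub>R duhamel f g"
    by (rule trajectory_eqI)
       (simp only: traj_coeff_duhamel traj_coeff_scaleR duhamel_coeff_def traj_conv_scaleR_left
          mult.left_commute[of _ "of_real r"] integral_mult_right)
  show "duhamel f (r *\<^sub>R g) = r *\<^sub>R duhamel f g"
    by (rule trajectory_eqI)
       (simp only: traj_coeff_duhamel traj_coeff_scaleR duhamel_coeff_def traj_conv_scaleR_right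
          mult.left_commute[of _ "of_real r"] integral_mult_right)
  show "\<exists>K. \<forall>f g. norm (duhamel f g) \<le> norm f * norm g * K"
    using norm_weighted_le[OF continuous_on_duhamel_coeff norm_duhamel_coeff_le]
    by (intro exI[of _ duhamel_const]) (simp add: duhamel_def mult_ac)
qed

definition free_evolution :: "(int \<Rightarrow> complex) \<Rightarrow> trajectory" where
  "free_evolution c = weighted (\<lambda>t k. propagator k (clamp_time t) * c k)"

lemma traj_coeff_free_evolution:
  assumes "\<And>k. norm (c k) \<le> M / weight k"
  shows "traj_coeff (free_evolution c) t k = propagator k (clamp_time t) * c k"
  unfolding free_evolution_def
proof (rule traj_coeff_weighted)
  show "continuous_on UNIV (\<lambda>t. propagator k (clamp_time t) * c k)" for k
    by (intro continuous_intros continuous_on_propagator continuous_on_clamp_time)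
  show "norm (propagator k (clamp_time t) * c k) \<le> M / weight k" for t k
    unfolding norm_mult using mult_mono[OF norm_propagator_le_1[OF clamp_time_mem(1)[of t], of k] assms[of k]]
    by simp
qed

section \<open>Small classical solutions and the flow map\<close>

lemma semigroup_eq_synth:
  "chen_lee_semigroup \<beta> \<eta> t f = fourier_synth (\<lambda>k. propagator k t * fourier_coeff f k)"
  unfolding chen_lee_semigroup_def fourier_multiplier_eq_synth propagator_eq ..

text \<open>All sums and integrals converge absolutely in the weighted space, so the fixed-point equation, read
coefficient by coefficient, is the weak integral equation for the synthesised distributions.\<close>

lemma fixed_point_is_solution:
  assumes s: "s \<le> 0" and c: "\<And>k. norm (c k) \<le> M / weight k" and u: "u = free_evolution c - duhamel u u"
  shows "chen_lee_solution \<beta> \<eta> s T (fourier_synth c) (\<lambda>t. fourier_synth (traj_coeff u t))"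
proof -
  note cu = norm_traj_coeff_le[of u]
  have fcu: "fourier_coeff (fourier_synth (traj_coeff u t)) k = traj_coeff u t k" for t k
    by (rule fourier_coeff_synth_of_decay[OF cu])
  let ?w = "\<lambda>t. fourier_synth (traj_conv u u t)"
  let ?C = "4 * weight_sum * norm u * norm u"
  have cw: "norm (traj_conv u u t k) \<le> ?C / weight k" for t k
    by (intro norm_conv_le cu)
  have fcw: "fourier_coeff (fourier_synth (traj_conv u u t)) k = traj_conv u u t k" for t k
    by (rule fourier_coeff_synth_of_decay[OF cw])
  have sol1: "fourier_synth (traj_coeff u t) \<in> sobolev s" for t
    by (rule sobolev_of_decay[OF s, of _ "norm u"]) (simp add: fcu cu)
  have sol2: "((\<lambda>t'. sobolev_norm s (fourier_synth (traj_coeff u t') - fourier_synth (traj_coeff u t))) \<longlongrightarrow> 0) (at t within {0..T})"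
    if "t \<in> {0..T}" for t
    by (rule sobolev_norm_continuous_of_decay[OF s _ _ that, where M = "norm u"])
       (simp_all add: fcu cu continuous_on_traj_coeff)
  have square: "is_square (fourier_synth (traj_coeff u t)) (?w t)" for t
    unfolding is_square_def fcu fcw
    unfolding conv_def by (intro allI has_sum_infsum conv_summable[OF cu cu])
  have duh: "\<exists>I. has_weak_integral
               (\<lambda>t'. chen_lee_semigroup \<beta> \<eta> (t - t') ((1 / 2) *\<^sub>R dist_deriv (?w t'))) I 0 t \<and>
             fourier_synth (traj_coeff u t) = chen_lee_semigroup \<beta> \<eta> t (fourier_synth c) - I"
    if t: "t \<in> {0..T}" for t
  proof (intro exI conjI)
    let ?h = "\<lambda>\<tau> k. propagator k (t - \<tau>) * (\<i> * of_int k / 2 * traj_conv u u \<tau> k)"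
    have hb: "norm (?h \<tau> k) \<le> ?C" if "\<tau> \<in> {0..t}" for \<tau> k
      using mult_mono[OF norm_propagator_le_1[of "t - \<tau>" k] weight_decay_derivative_bounded[of "traj_conv u u \<tau>" k ?C, OF cw]] that
      by (simp add: norm_mult)
    show "has_weak_integral (\<lambda>t'. chen_lee_semigroup \<beta> \<eta> (t - t') ((1 / 2) *\<^sub>R dist_deriv (?w t')))
        (fourier_synth (\<lambda>k. integral {0..t} (\<lambda>\<tau>. ?h \<tau> k))) 0 t"
    proof (rule has_weak_integral_synth[OF continuous_on_duhamel_integrand hb])
      fix \<tau>
      show "chen_lee_semigroup \<beta> \<eta> (t - \<tau>) ((1 / 2) *\<^sub>R dist_deriv (?w \<tau>)) = fourier_synth (?h \<tau>)"
        by (simp add: semigroup_eq_synth fourier_coeff_scaleR fourier_coeff_dist_deriv fcw)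
    qed (use t in auto)
    have I: "integral {0..t} (\<lambda>\<tau>. ?h \<tau> k) = traj_coeff (duhamel u u) t k" for k
      using t by (simp add: traj_coeff_duhamel duhamel_coeff_def)
    have fc: "fourier_coeff (fourier_synth c) k = c k" for k
      by (rule fourier_coeff_synth_of_decay[OF c])
    have f: "propagator k t * fourier_coeff (fourier_synth c) k = traj_coeff (free_evolution c) t k" for k
      using t by (simp add: traj_coeff_free_evolution[OF c] fc)
    have "traj_coeff u t = (\<lambda>k. traj_coeff (free_evolution c) t k - traj_coeff (duhamel u u) t k)"
      by (subst u) (auto simp: traj_coeff_diff)
    moreover have "fourier_synth (traj_coeff (free_evolution c) t) - fourier_synth (traj_coeff (duhamel u u) t)
        = fourier_synth (\<lambda>k. traj_coeff (free_evolution c) t k - traj_coeff (duhamel u u) t k)"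
      by (rule synth_diff) (rule weight_decay_bounded[OF norm_traj_coeff_le])+
    ultimately show "fourier_synth (traj_coeff u t)
        = chen_lee_semigroup \<beta> \<eta> t (fourier_synth c) - fourier_synth (\<lambda>k. integral {0..t} (\<lambda>\<tau>. ?h \<tau> k))"
      unfolding semigroup_eq_synth f I by simp
  qed
  show ?thesis unfolding chen_lee_solution_def
    by (intro conjI ballI sol1 sol2 exI[of _ ?w] duh AE_I2 square)
qed

text \<open>The constructed solution satisfies the hypotheses of the uniqueness clause, so it is the flow; the
remainder in \<open>quadratic_perturbation\<close> bounds each single coefficient.\<close>

lemma flow_map_expansion:
  assumes flow: "is_flow_map \<beta> \<eta> s T \<Phi>" and s: "s \<le> 0"
    and c: "\<And>k. norm (c k) \<le> M / weight k"
  obtains \<rho> C where "0 < \<rho>"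
    "\<And>r. \<bar>r\<bar> < \<rho> \<Longrightarrow> norm (fourier_coeff (\<Phi> T (r *\<^sub>R fourier_synth c)) k
        - (of_real r * (propagator k T * c k) - of_real (r\<^sup>2) * duhamel_coeff (free_evolution c) (free_evolution c) T k))
      \<le> C * \<bar>r\<bar> ^ 3"
proof -
  interpret bounded_bilinear duhamel by (rule bounded_bilinear_duhamel)
  obtain r0 C where r0: "0 < r0" "0 \<le> C" "\<And>g. norm g < r0 \<Longrightarrow>
      \<exists>u. u = g - duhamel u u \<and> norm (u - (g - duhamel g g)) \<le> C * norm g ^ 3"
    using quadratic_perturbation[OF bounded_bilinear_duhamel complete_bcontfun] by metis
  let ?n = "norm (free_evolution c)"
  show thesis
  proof (rule that)
    show "0 < r0 / (?n + 1)" using r0(1) by (simp add: add_nonneg_pos)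
    fix r assume r: "\<bar>r\<bar> < r0 / (?n + 1)"
    have "norm (r *\<^sub>R free_evolution c) \<le> \<bar>r\<bar> * (?n + 1)" by (simp add: mult_left_mono)
    also have "\<dots> < r0" using r by (simp add: pos_less_divide_eq add_nonneg_pos)
    finally obtain u where u: "u = r *\<^sub>R free_evolution c - duhamel u u"
        "norm (u - (r *\<^sub>R free_evolution c - duhamel (r *\<^sub>R free_evolution c) (r *\<^sub>R free_evolution c))) \<le> C * norm (r *\<^sub>R free_evolution c) ^ 3"
      using r0(3) by blast
    have rc: "norm (of_real r * c k) \<le> (\<bar>r\<bar> * M) / weight k" for k
      using mult_left_mono[OF c[of k] abs_ge_zero[of r]] by (simp add: norm_mult)
    have "free_evolution (\<lambda>k. of_real r * c k) = r *\<^sub>R free_evolution c"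
      by (rule trajectory_eqI) (simp add: traj_coeff_free_evolution[OF rc] traj_coeff_scaleR traj_coeff_free_evolution[OF c])
    moreover have "fourier_synth (\<lambda>k. of_real r * c k) = r *\<^sub>R fourier_synth c"
      by (rule synth_scaleR[OF weight_decay_bounded[OF c], symmetric])
    ultimately have "chen_lee_solution \<beta> \<eta> s T (r *\<^sub>R fourier_synth c) (\<lambda>t. fourier_synth (traj_coeff u t))"
      using fixed_point_is_solution[OF s rc, of u] u(1) by simp
    moreover have "r *\<^sub>R fourier_synth c \<in> sobolev s"
      by (intro sobolev_scaleR sobolev_of_decay[OF s, of _ M])
         (simp add: fourier_coeff_synth_of_decay[OF c] c)
    ultimately have "fourier_synth (traj_coeff u T) = \<Phi> T (r *\<^sub>R fourier_synth c)"
      using flow T_pos by (auto simp: is_flow_map_def)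
    moreover have "fourier_coeff (fourier_synth (traj_coeff u T)) k = traj_coeff u T k"
      by (rule fourier_coeff_synth_of_decay[OF norm_traj_coeff_le])
    ultimately have "fourier_coeff (\<Phi> T (r *\<^sub>R fourier_synth c)) k = traj_coeff u T k" by simp
    moreover have "of_real r * (propagator k T * c k) - of_real (r\<^sup>2) * duhamel_coeff (free_evolution c) (free_evolution c) T k
        = traj_coeff (r *\<^sub>R free_evolution c - duhamel (r *\<^sub>R free_evolution c) (r *\<^sub>R free_evolution c)) T k"
      using T_pos
      by (simp add: traj_coeff_diff traj_coeff_scaleR scaleR_left scaleR_right traj_coeff_duhamel
          traj_coeff_free_evolution[OF c] power2_eq_square)
    ultimately have "norm (fourier_coeff (\<Phi> T (r *\<^sub>R fourier_synth c)) k
        - (of_real r * (propagator k T * c k) - of_real (r\<^sup>2) * duhamel_coeff (free_evolution c) (free_evolution c) T k))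
      = norm (traj_coeff (u - (r *\<^sub>R free_evolution c - duhamel (r *\<^sub>R free_evolution c) (r *\<^sub>R free_evolution c))) T k)"
      by (simp add: traj_coeff_diff)
    also have "\<dots> \<le> norm (u - (r *\<^sub>R free_evolution c - duhamel (r *\<^sub>R free_evolution c) (r *\<^sub>R free_evolution c)))"
      by (rule weight_decay_bounded[OF norm_traj_coeff_le])
    also have "\<dots> \<le> (C * ?n ^ 3) * \<bar>r\<bar> ^ 3"
      using u(2) by (simp add: power_mult_distrib mult_ac)
    finally show "norm (fourier_coeff (\<Phi> T (r *\<^sub>R fourier_synth c)) k
        - (of_real r * (propagator k T * c k) - of_real (r\<^sup>2) * duhamel_coeff (free_evolution c) (free_evolution c) T k))
      \<le> (C * ?n ^ 3) * \<bar>r\<bar> ^ 3" .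
  qed
qed

end

section \<open>Second-order terms of maps of class \<open>C\<^sup>2\<close>\<close>

text \<open>A uniqueness statement for second-order Taylor expansions. The cubic bound forces \<open>h1 0 = 0\<close>; since \<open>h1\<close> is
known to be differentiable at \<open>0\<close> only, the mean value inequality is applied to \<open>h x - x\<^sup>2 / 2 * d\<close>, whose
derivative is \<open>o(x)\<close>.\<close>

lemma second_derivative_eq_0:
  fixes h h1 :: "real \<Rightarrow> 'a::real_normed_vector"
  assumes h: "\<And>x. (h has_vector_derivative h1 x) (at x)"
    and h1: "(h1 has_vector_derivative d) (at 0)"
    and bnd: "0 < r" "\<And>x. \<bar>x\<bar> < r \<Longrightarrow> norm (h x) \<le> C * \<bar>x\<bar> ^ 3"
  shows "d = 0"
proof -
  have h0: "h 0 = 0" using bnd(2)[of 0] bnd(1) by simp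
  have cube: "((\<lambda>x::real. C * \<bar>x\<bar> ^ 3 / \<bar>x\<bar>) \<longlongrightarrow> 0) (at 0)"
  proof -
    have "((\<lambda>x::real. C * \<bar>x\<bar> ^ 2) \<longlongrightarrow> C * \<bar>0\<bar> ^ 2) (at 0)" by (intro tendsto_intros)
    then have "((\<lambda>x::real. C * \<bar>x\<bar> ^ 2) \<longlongrightarrow> 0) (at 0)" by simp
    then show ?thesis
      by (rule Lim_transform_eventually)
         (auto simp: eventually_at_filter power3_eq_cube power2_eq_square)
  qed
  have "(h has_vector_derivative 0) (at 0)"
    unfolding has_vector_derivative_def has_derivative_at2
  proof (intro conjI)
    have "eventually (\<lambda>x. \<bar>x\<bar> < r) (at (0::real))"
      using bnd(1) by (auto simp: eventually_at dist_real_def intro!: exI[of _ r])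
    then have "\<forall>\<^sub>F x in at 0. norm ((1 / norm (x - 0)) *\<^sub>R (h x - (h 0 + (x - 0) *\<^sub>R 0))) \<le> C * \<bar>x\<bar> ^ 3 / \<bar>x\<bar>"
      by eventually_elim (use bnd(2) h0 in \<open>auto simp: divide_inverse mult.commute intro!: mult_left_mono\<close>)
    then show "(\<lambda>y. (1 / norm (y - 0)) *\<^sub>R (h y - (h 0 + (y - 0) *\<^sub>R 0))) \<midarrow>0\<rightarrow> 0"
      by (rule Lim_null_comparison[OF _ cube])
  qed simp
  then have h10: "h1 0 = 0" using vector_derivative_unique_at h by blast
  have small: "norm d \<le> e" if e: "e > 0" for e
  proof -
    obtain \<delta> where \<delta>: "\<delta> > 0" "\<And>x. norm x < \<delta> \<Longrightarrow> norm (h1 x - x *\<^sub>R d) \<le> e/4 * norm x"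
      using h1[unfolded has_vector_derivative_def has_derivative_at_alt, THEN conjunct2,
          rule_format, of "e/4"] e h10 by auto
    define K where "K = 1 + \<bar>C\<bar>"
    \<comment> \<open>\<open>x \<le> e / (4 K)\<close> turns the cubic bound \<open>K x\<^sup>3\<close> into \<open>e x\<^sup>2 / 4\<close>.\<close>
    define x where "x = Min {\<delta>/2, r/2, e/(4*K)}"
    have K: "K > 0" "C \<le> K" by (auto simp: K_def)
    have x: "0 < x" "x < \<delta>" "x < r" "x \<le> e/(4*K)"
      using \<delta>(1) bnd(1) e K by (auto simp: x_def min_def)
    have "norm ((h x - (x\<^sup>2/2) *\<^sub>R d) - (h 0 - (0\<^sup>2/2) *\<^sub>R d)) \<le> (e/4 * x) * norm (x - 0)"
    proof (rule differentiable_bound[where S = "{0..x}" and f' = "\<lambda>t u. u *\<^sub>R (h1 t - t *\<^sub>R d)"])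
      fix t assume t: "t \<in> {0..x}"
      have "((\<lambda>x. h x - (x\<^sup>2/2) *\<^sub>R d) has_vector_derivative (h1 t - t *\<^sub>R d)) (at t)"
        by (auto intro!: derivative_eq_intros h simp: has_real_derivative_iff_has_vector_derivative[symmetric])
      then show "((\<lambda>x. h x - (x\<^sup>2/2) *\<^sub>R d) has_derivative (\<lambda>u. u *\<^sub>R (h1 t - t *\<^sub>R d))) (at t within {0..x})"
        by (simp add: has_vector_derivative_def has_derivative_at_withinI)
      have "norm (h1 t - t *\<^sub>R d) \<le> e/4 * x"
        by (rule order_trans[OF \<delta>(2)]) (use t x e in \<open>auto intro!: mult_left_mono\<close>)
      then have "norm (u *\<^sub>R (h1 t - t *\<^sub>R d)) \<le> \<bar>u\<bar> * (e/4 * x)" for u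
        unfolding norm_scaleR by (rule mult_left_mono) simp
      then show "onorm (\<lambda>u. u *\<^sub>R (h1 t - t *\<^sub>R d)) \<le> e/4 * x"
        by (intro onorm_le) (metis mult.commute real_norm_def)
    qed (use x in auto)
    then have 1: "norm (h x - (x\<^sup>2/2) *\<^sub>R d) \<le> e/4 * x\<^sup>2"
      using x by (simp add: h0 power2_eq_square)
    have "norm (h x) \<le> K * x ^ 3"
      by (rule order_trans[OF bnd(2)]) (use x K in \<open>auto intro!: mult_right_mono\<close>)
    also have "\<dots> = K * x * x\<^sup>2" by (simp add: power3_eq_cube power2_eq_square)
    also have "\<dots> \<le> e/4 * x\<^sup>2"
      by (rule mult_right_mono) (use x K in \<open>auto simp: field_simps\<close>)
    finally have "norm ((x\<^sup>2/2) *\<^sub>R d) \<le> e/4 * x\<^sup>2 + e/4 * x\<^sup>2"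
      using 1 norm_triangle_sub[of "(x\<^sup>2/2) *\<^sub>R d" "h x"] by (simp add: norm_minus_commute)
    then have "x\<^sup>2 * norm d \<le> x\<^sup>2 * e" by (simp add: field_simps)
    then show ?thesis using x by simp
  qed
  have "norm d \<le> 0" by (rule field_le_epsilon) (use small in auto)
  then show "d = 0" by simp
qed

text \<open>Fourier coefficients are continuous for the Sobolev norm, so a curve that is differentiable in norm has
differentiable coefficients. The factors \<open>N\<close> and \<open>N'\<close> allow the increment of the curve to be measured along a
fixed direction.\<close>

lemma sobolev_curve_derivative:
  assumes N: "0 \<le> N" "0 \<le> N'"
    and P: "\<And>\<epsilon>. 0 < \<epsilon> \<Longrightarrow> \<exists>\<delta>>0. \<forall>e. \<bar>e\<bar> * N < \<delta> \<longrightarrow>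
        P (r + e) - P r - e *\<^sub>R L \<in> sobolev s \<and>
        sobolev_norm s (P (r + e) - P r - e *\<^sub>R L) \<le> \<epsilon> * \<bar>e\<bar> * N'"
  shows "((\<lambda>r. fourier_coeff (P r) k) has_vector_derivative fourier_coeff L k) (at r)"
  unfolding has_vector_derivative_def has_derivative_at_alt
proof (intro conjI allI impI)
  show "bounded_linear (\<lambda>h. h *\<^sub>R fourier_coeff L k)" by (rule bounded_linear_scaleR_left)
  fix \<epsilon> :: real assume \<epsilon>: "0 < \<epsilon>"
  define W where "W = (1 + (of_int k)\<^sup>2 :: real) powr (- s / 2)"
  have W: "0 \<le> W" by (simp add: W_def)
  \<comment> \<open>The summand \<open>1\<close> keeps the divisor positive when \<open>N' = 0\<close>.\<close>
  define \<epsilon>' where "\<epsilon>' = \<epsilon> / (W * N' + 1)"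
  have WN: "0 < W * N' + 1" using N W by (simp add: add_nonneg_pos)
  then have "0 < \<epsilon>'" using \<epsilon> by (simp add: \<epsilon>'_def)
  then obtain \<delta> where \<delta>: "0 < \<delta>" "\<And>e. \<bar>e\<bar> * N < \<delta> \<Longrightarrow>
        P (r + e) - P r - e *\<^sub>R L \<in> sobolev s \<and>
        sobolev_norm s (P (r + e) - P r - e *\<^sub>R L) \<le> \<epsilon>' * \<bar>e\<bar> * N'"
    using P by blast
  show "\<exists>d>0. \<forall>y. norm (y - r) < d \<longrightarrow>
      norm (fourier_coeff (P y) k - fourier_coeff (P r) k - (y - r) *\<^sub>R fourier_coeff L k) \<le> \<epsilon> * norm (y - r)"
  proof (intro exI conjI allI impI)
    show "0 < \<delta> / (N + 1)" using \<delta> N by simp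
    fix y assume y: "norm (y - r) < \<delta> / (N + 1)"
    define e where "e = y - r"
    have "\<bar>e\<bar> * N \<le> \<bar>e\<bar> * (N + 1)" by (simp add: mult_left_mono)
    also have "\<dots> < \<delta>" using y N by (simp add: e_def field_simps)
    finally have 1: "P (r + e) - P r - e *\<^sub>R L \<in> sobolev s"
        "sobolev_norm s (P (r + e) - P r - e *\<^sub>R L) \<le> \<epsilon>' * \<bar>e\<bar> * N'" using \<delta>(2) by auto
    have "norm (fourier_coeff (P (r + e) - P r - e *\<^sub>R L) k) \<le> W * (\<epsilon>' * \<bar>e\<bar> * N')"
      using fourier_coeff_le_sobolev_norm[OF 1(1), of k] mult_left_mono[OF 1(2) W]
      by (simp add: W_def)
    also have "\<dots> \<le> (W * N' + 1) * \<epsilon>' * \<bar>e\<bar>"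
      using \<open>0 < \<epsilon>'\<close> by (simp add: algebra_simps)
    also have "\<dots> = \<epsilon> * \<bar>e\<bar>" using WN by (simp add: \<epsilon>'_def)
    finally show "norm (fourier_coeff (P y) k - fourier_coeff (P r) k - (y - r) *\<^sub>R fourier_coeff L k)
        \<le> \<epsilon> * norm (y - r)"
      by (simp add: e_def fourier_coeff_diff fourier_coeff_scaleR scaleR_conv_of_real)
  qed
qed

text \<open>By uniqueness of the second-order expansion the coefficient \<open>- b\<close> of \<open>r\<^sup>2\<close> is half the Fourier coefficient
of \<open>D2 0 \<phi> \<phi>\<close>, and \<open>D2 0\<close> is bounded. The point is that \<open>K\<close> depends neither on \<open>\<phi>\<close> nor on the size of
\<open>\<rho>\<close> and \<open>C\<close>.\<close>

lemma C2_map_second_coeff_bounded: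
  assumes "C2_map (sobolev s) (sobolev_norm s) (sobolev s) (sobolev_norm s) F"
  obtains K where "\<And>\<phi> a b \<rho> C. \<phi> \<in> sobolev s \<Longrightarrow> 0 < \<rho> \<Longrightarrow>
      (\<And>r. \<bar>r\<bar> < \<rho> \<Longrightarrow>
        norm (fourier_coeff (F (r *\<^sub>R \<phi>)) k - (of_real r * a - of_real (r\<^sup>2) * b)) \<le> C * \<bar>r\<bar> ^ 3) \<Longrightarrow>
      norm b \<le> K * (sobolev_norm s \<phi>)\<^sup>2"
proof -
  let ?X = "sobolev s" and ?N = "sobolev_norm s"
  obtain D1 D2 where F: "\<forall>x\<in>?X. F x \<in> ?X"
    and L1: "\<forall>x\<in>?X. bounded_linear_map ?X ?N ?X ?N (D1 x)"
    and B2: "\<forall>x\<in>?X. bounded_bilinear_map ?X ?N ?X ?N (D2 x)"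
    and d1: "\<forall>x\<in>?X. \<forall>\<epsilon>>0. \<exists>\<delta>>0. \<forall>h\<in>?X. ?N h < \<delta> \<longrightarrow>
            ?N (F (x + h) - F x - D1 x h) \<le> \<epsilon> * ?N h"
    and d2: "\<forall>x\<in>?X. \<forall>\<epsilon>>0. \<exists>\<delta>>0. \<forall>h\<in>?X. ?N h < \<delta> \<longrightarrow>
            (\<forall>v\<in>?X. ?N (D1 (x + h) v - D1 x v - D2 x h v) \<le> \<epsilon> * ?N h * ?N v)"
    using assms unfolding C2_map_def by blast
  note F = F[rule_format] and L1 = L1[rule_format] and B2 = B2[rule_format]
    and d1 = d1[rule_format] and d2 = d2[rule_format]
  have zero: "0 \<in> ?X" by (simp add: sobolev_def fourier_coeff_def zero_pdist.rep_eq)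
  obtain K where K: "\<And>v w. v \<in> ?X \<Longrightarrow> w \<in> ?X \<Longrightarrow> ?N (D2 0 v w) \<le> K * ?N v * ?N w"
    using B2[OF zero] unfolding bounded_bilinear_map_def by blast
  define W where "W = (1 + (of_int k)\<^sup>2 :: real) powr (- s / 2)"
  show thesis
  proof (rule that[of "W * K / 2"])
    fix \<phi> a b \<rho> C
    assume \<phi>: "\<phi> \<in> ?X" and \<rho>: "0 < (\<rho>::real)"
      and ex: "\<And>r. \<bar>r\<bar> < \<rho> \<Longrightarrow>
        norm (fourier_coeff (F (r *\<^sub>R \<phi>)) k - (of_real r * a - of_real (r\<^sup>2) * b)) \<le> C * \<bar>r\<bar> ^ 3"
    note sc = sobolev_scaleR[OF \<phi>]
    have D1: "D1 x (r *\<^sub>R \<phi>) = r *\<^sub>R D1 x \<phi>" "D1 x \<phi> \<in> ?X" if "x \<in> ?X" for x r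
      using L1[OF that] \<phi> by (auto simp: bounded_linear_map_def)
    have D2: "D2 0 (r *\<^sub>R \<phi>) \<phi> = r *\<^sub>R D2 0 \<phi> \<phi>" "D2 0 \<phi> \<phi> \<in> ?X" for r
      using B2[OF zero] \<phi> by (auto simp: bounded_bilinear_map_def bounded_linear_map_def)
    have der1: "((\<lambda>r. fourier_coeff (F (r *\<^sub>R \<phi>)) k) has_vector_derivative
        fourier_coeff (D1 (r *\<^sub>R \<phi>) \<phi>) k) (at r)" for r
    proof (rule sobolev_curve_derivative[where N = "?N \<phi>" and N' = "?N \<phi>" and s = s])
      fix \<epsilon> :: real assume "0 < \<epsilon>"
      then obtain \<delta> where \<delta>: "\<delta> > 0" "\<And>h. h \<in> ?X \<Longrightarrow> ?N h < \<delta> \<Longrightarrow>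
          ?N (F (r *\<^sub>R \<phi> + h) - F (r *\<^sub>R \<phi>) - D1 (r *\<^sub>R \<phi>) h) \<le> \<epsilon> * ?N h"
        using d1[OF sc] by blast
      show "\<exists>\<delta>>0. \<forall>e. \<bar>e\<bar> * ?N \<phi> < \<delta> \<longrightarrow>
          F ((r + e) *\<^sub>R \<phi>) - F (r *\<^sub>R \<phi>) - e *\<^sub>R D1 (r *\<^sub>R \<phi>) \<phi> \<in> ?X \<and>
          ?N (F ((r + e) *\<^sub>R \<phi>) - F (r *\<^sub>R \<phi>) - e *\<^sub>R D1 (r *\<^sub>R \<phi>) \<phi>) \<le> \<epsilon> * \<bar>e\<bar> * ?N \<phi>"
        using \<delta>(1) \<delta>(2)[OF sc]
        by (intro exI[of _ \<delta>])
           (auto simp: sobolev_norm_scaleR scaleR_add_left D1[OF sc] mult.assoc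
             intro!: sobolev_diff F sc sobolev_scaleR D1 sobolev_add)
    qed (rule sobolev_norm_nonneg)+
    have der2: "((\<lambda>r. fourier_coeff (D1 (r *\<^sub>R \<phi>) \<phi>) k) has_vector_derivative
        fourier_coeff (D2 0 \<phi> \<phi>) k) (at 0)"
    proof (rule sobolev_curve_derivative[where N = "?N \<phi>" and N' = "?N \<phi> * ?N \<phi>" and s = s])
      fix \<epsilon> :: real assume "0 < \<epsilon>"
      then obtain \<delta> where \<delta>: "\<delta> > 0" "\<And>h. h \<in> ?X \<Longrightarrow> ?N h < \<delta> \<Longrightarrow>
          ?N (D1 (0 + h) \<phi> - D1 0 \<phi> - D2 0 h \<phi>) \<le> \<epsilon> * ?N h * ?N \<phi>"
        using d2[OF zero] \<phi> by blast
      show "\<exists>\<delta>>0. \<forall>e. \<bar>e\<bar> * ?N \<phi> < \<delta> \<longrightarrow>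
          D1 ((0 + e) *\<^sub>R \<phi>) \<phi> - D1 (0 *\<^sub>R \<phi>) \<phi> - e *\<^sub>R D2 0 \<phi> \<phi> \<in> ?X \<and>
          ?N (D1 ((0 + e) *\<^sub>R \<phi>) \<phi> - D1 (0 *\<^sub>R \<phi>) \<phi> - e *\<^sub>R D2 0 \<phi> \<phi>) \<le> \<epsilon> * \<bar>e\<bar> * (?N \<phi> * ?N \<phi>)"
        using \<delta>(1) \<delta>(2)[OF sc]
        by (intro exI[of _ \<delta>])
           (auto simp: sobolev_norm_scaleR D2(1) mult.assoc
             intro!: sobolev_diff sc sobolev_scaleR D1 D2 zero)
    qed (intro sobolev_norm_nonneg mult_nonneg_nonneg)+
    let ?h = "\<lambda>r. fourier_coeff (F (r *\<^sub>R \<phi>)) k - (of_real r * a - of_real (r\<^sup>2) * b)"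
    have "fourier_coeff (D2 0 \<phi> \<phi>) k - (- 2 * b) = 0"
    proof (rule second_derivative_eq_0[where h = ?h and C = C, OF _ _ \<rho> ex])
      have lin: "((\<lambda>r. of_real r * a - of_real (r\<^sup>2) * b) has_vector_derivative (a - of_real (2 * r) * b)) (at r)" for r
        unfolding has_vector_derivative_def
        by (auto intro!: derivative_eq_intros simp: fun_eq_iff scaleR_conv_of_real algebra_simps)
      show "(?h has_vector_derivative
          fourier_coeff (D1 (r *\<^sub>R \<phi>) \<phi>) k - (a - of_real (2 * r) * b)) (at r)" for r
        by (intro has_vector_derivative_diff der1 lin)
      have "((\<lambda>r. a - of_real (2 * r) * b) has_vector_derivative - 2 * b) (at 0)"
        unfolding has_vector_derivative_def
        by (auto intro!: derivative_eq_intros simp: fun_eq_iff scaleR_conv_of_real algebra_simps)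
      then show "((\<lambda>r. fourier_coeff (D1 (r *\<^sub>R \<phi>) \<phi>) k - (a - of_real (2 * r) * b))
          has_vector_derivative fourier_coeff (D2 0 \<phi> \<phi>) k - (- 2 * b)) (at 0)"
        by (intro has_vector_derivative_diff der2)
    qed
    then have "2 * norm b = norm (fourier_coeff (D2 0 \<phi> \<phi>) k)"
      by (simp add: eq_neg_iff_add_eq_0[symmetric] norm_mult)
    also have "\<dots> \<le> W * ?N (D2 0 \<phi> \<phi>)"
      unfolding W_def by (rule fourier_coeff_le_sobolev_norm[OF D2(2)])
    also have "\<dots> \<le> W * (K * ?N \<phi> * ?N \<phi>)"
      by (intro mult_left_mono K \<phi>) (simp add: W_def)
    finally show "norm b \<le> W * K / 2 * (?N \<phi>)\<^sup>2" by (simp add: power2_eq_square mult_ac)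
  qed
qed

section \<open>Two interacting high frequencies\<close>

text \<open>Coefficients of \<open>exp (\<i> (m + 1) x) + exp (- \<i> m x)\<close>: two high frequencies with sum \<open>1\<close>.\<close>

definition two_modes :: "int \<Rightarrow> int \<Rightarrow> complex" where
  "two_modes m k = (if k = m + 1 \<or> k = - m then 1 else 0)"

lemma two_modes_decay:
  assumes "0 \<le> m"
  shows "norm (two_modes m k) \<le> weight (m + 1) / weight k"
proof -
  have "weight (- m) \<le> weight (m + 1)"
    using assms unfolding weight_def by (intro power_mono) auto
  then show ?thesis using weight_pos by (auto simp: two_modes_def less_imp_le)
qed

lemma sobolev_norm_two_modes:
  assumes m: "1 \<le> m" and s: "s \<le> 0"
  shows "(sobolev_norm s (fourier_synth (two_modes m)))\<^sup>2 \<le> 4 * pi * of_int m powr (2 * s)"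
proof -
  have fc: "fourier_coeff (fourier_synth (two_modes m)) k = two_modes m k" for k
    using two_modes_decay[of m] m by (intro fourier_coeff_synth_of_decay) auto
  have bd: "((1 + (of_int k)\<^sup>2) powr (s / 2))\<^sup>2 \<le> of_int m powr (2 * s)" if "m \<le> \<bar>k\<bar>" for k
  proof -
    have "of_int m \<le> \<bar>of_int k :: real\<bar>" using that by (metis of_int_abs of_int_le_iff)
    then have "(of_int m)\<^sup>2 \<le> \<bar>of_int k :: real\<bar>\<^sup>2" using m by (intro power_mono) auto
    then have le: "(of_int m)\<^sup>2 \<le> 1 + (of_int k :: real)\<^sup>2" by simp
    have "((1 + (of_int k)\<^sup>2) powr (s / 2))\<^sup>2 = (1 + (of_int k)\<^sup>2 :: real) powr s"
      by (simp add: power2_eq_square powr_add[symmetric])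
    also have "\<dots> \<le> ((of_int m)\<^sup>2) powr s" using le s m by (intro powr_mono2') auto
    also have "\<dots> = of_int m powr (2 * s)"
      using m by (simp add: powr_powr flip: powr_numeral)
    finally show ?thesis .
  qed
  have "(sobolev_norm s (fourier_synth (two_modes m)))\<^sup>2 = 2 * pi * (\<Sum>\<^sub>\<infinity>k. sobolev_term s (fourier_synth (two_modes m)) k)"
    unfolding sobolev_norm_def power_mult_distrib
    by (subst real_sqrt_pow2, simp, subst real_sqrt_pow2, auto intro: infsum_nonneg)
  also have "(\<Sum>\<^sub>\<infinity>k. sobolev_term s (fourier_synth (two_modes m)) k)
      = (\<Sum>\<^sub>\<infinity>k\<in>{m + 1, - m}. sobolev_term s (fourier_synth (two_modes m)) k)"
    by (rule infsum_cong_neutral) (auto simp: fc two_modes_def)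
  also have "\<dots> = ((1 + (of_int (m + 1))\<^sup>2) powr (s / 2))\<^sup>2 + ((1 + (of_int (- m))\<^sup>2) powr (s / 2))\<^sup>2"
    using m by (simp add: fc two_modes_def)
  also have "\<dots> \<le> of_int m powr (2 * s) + of_int m powr (2 * s)"
    using m by (intro add_mono bd) auto
  finally show ?thesis by simp
qed

context chen_lee
begin

text \<open>The integral at frequency \<open>1\<close> equals, up to a factor of modulus \<open>1\<close>, \<open>(1 - exp (- z T)) / z\<close>, where \<open>- z\<close>
is the sum of the symbols of the two waves minus the symbol at \<open>1\<close>. Dissipation makes \<open>Re z = 2 \<eta> m\<^sup>2\<close>, and
the dispersive part \<open>Im z\<close> is only of order \<open>m\<close>, so \<open>z\<close> has exact order \<open>m\<^sup>2\<close>.\<close>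

lemma duhamel_two_modes_lower:
  assumes m: "1 \<le> m"
  shows "(1 - exp (- 2 * \<eta> * T)) / (2 * (\<eta> + \<bar>\<beta>\<bar>)) * of_int m powr (-2)
      \<le> norm (duhamel_coeff (free_evolution (two_modes m)) (free_evolution (two_modes m)) T 1)"
proof -
  let ?m = "of_int m :: real"
  have m1: "1 \<le> ?m" using m by simp
  define z where "z = symbol 1 - symbol (m + 1) - symbol (- m)"
  have cv: "traj_conv (free_evolution (two_modes m)) (free_evolution (two_modes m)) \<tau> 1
      = 2 * (propagator (m + 1) \<tau> * propagator (- m) \<tau>)" if "\<tau> \<in> {0..T}" for \<tau>
  proof -
    have "traj_conv (free_evolution (two_modes m)) (free_evolution (two_modes m)) \<tau> 1
        = (\<Sum>\<^sub>\<infinity>j. (propagator j \<tau> * two_modes m j) * (propagator (1 - j) \<tau> * two_modes m (1 - j)))"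
      using that m by (simp add: conv_def traj_coeff_free_evolution[OF two_modes_decay])
    also have "\<dots> = (\<Sum>\<^sub>\<infinity>j\<in>{m + 1, - m}.
        (propagator j \<tau> * two_modes m j) * (propagator (1 - j) \<tau> * two_modes m (1 - j)))"
      by (rule infsum_cong_neutral) (auto simp: two_modes_def)
    also have "\<dots> = 2 * (propagator (m + 1) \<tau> * propagator (- m) \<tau>)"
      using m by (simp add: two_modes_def add.commute)
    finally show ?thesis .
  qed
  have Re_z: "Re z = 2 * \<eta> * ?m\<^sup>2"
    using m1 by (simp add: z_def symbol_def p_eq power2_eq_square algebra_simps)
  have Im_z: "Im z = - 2 * \<beta> * ?m"
    using m1 by (simp add: z_def symbol_def chen_lee_q_def power2_eq_square algebra_simps)
 have T_mem: "T \<in> {0..T}" using T_pos by simp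
  have z0: "z \<noteq> 0" using Re_z m1 eta_pos by auto
  have "duhamel_coeff (free_evolution (two_modes m)) (free_evolution (two_modes m)) T 1
      = integral {0..T} (\<lambda>\<tau>. (\<i> * propagator 1 T) * exp (- z * of_real \<tau>))"
    unfolding duhamel_coeff_def clamp_time_id[OF T_mem]
  proof (rule integral_cong)
    fix \<tau> assume \<tau>: "\<tau> \<in> {0..T}"
    have "propagator 1 (T - \<tau>) * (propagator (m + 1) \<tau> * propagator (- m) \<tau>)
        = propagator 1 T * exp (- z * of_real \<tau>)"
      by (simp add: propagator_def z_def exp_add[symmetric] algebra_simps)
    then show "propagator 1 (T - \<tau>) * (\<i> * of_int 1 / 2 *
          traj_conv (free_evolution (two_modes m)) (free_evolution (two_modes m)) \<tau> 1)
        = (\<i> * propagator 1 T) * exp (- z * of_real \<tau>)"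
      by (simp add: cv[OF \<tau>])
  qed
  also have "\<dots> = (\<i> * propagator 1 T) * ((1 - exp (- z * of_real T)) / z)"
  proof -
    have "((\<lambda>\<tau>. exp (- z * of_real \<tau>)) has_integral
        (- exp (- z * of_real T) / z - - exp (- z * of_real 0) / z)) {0..T}"
    proof (rule fundamental_theorem_of_calculus)
      fix \<tau> :: real
      have "((\<lambda>w. - exp (- z * w) / z) has_field_derivative exp (- z * of_real \<tau>)) (at (of_real \<tau>))"
        using z0 by (auto intro!: derivative_eq_intros)
      then show "((\<lambda>\<tau>. - exp (- z * of_real \<tau>) / z) has_vector_derivative exp (- z * of_real \<tau>))
          (at \<tau> within {0..T})"
        by (rule has_vector_derivative_real_field)
    qed (use T_pos in simp)
    then have "integral {0..T} (\<lambda>\<tau>. exp (- z * of_real \<tau>)) = (1 - exp (- z * of_real T)) / z"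
      by (simp add: integral_unique diff_divide_distrib)
    then show ?thesis by simp
  qed
  finally have eq: "norm (duhamel_coeff (free_evolution (two_modes m)) (free_evolution (two_modes m)) T 1)
      = norm (1 - exp (- z * of_real T)) / norm z"
    by (simp add: norm_mult norm_divide norm_propagator p_eq)
  have mm: "?m \<le> ?m\<^sup>2" "1 \<le> ?m\<^sup>2" using m1 by (auto simp: self_le_power)
  have "norm z \<le> 2 * \<eta> * ?m\<^sup>2 + 2 * \<bar>\<beta>\<bar> * ?m"
    using cmod_le[of z] eta_pos m1 by (simp add: Re_z Im_z abs_mult)
  also have "\<dots> \<le> 2 * \<eta> * ?m\<^sup>2 + 2 * \<bar>\<beta>\<bar> * ?m\<^sup>2"
    using mm by (intro add_left_mono mult_left_mono) auto
  finally have z_le: "norm z \<le> 2 * (\<eta> + \<bar>\<beta>\<bar>) * ?m\<^sup>2" by (simp add: algebra_simps)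
  have "norm (exp (- z * of_real T)) = exp (- 2 * \<eta> * T * ?m\<^sup>2)"
    by (simp add: norm_exp Re_z mult_ac)
  also have "\<dots> \<le> exp (- 2 * \<eta> * T * 1)"
    unfolding exp_le_cancel_iff using mm eta_pos T_pos by (intro mult_left_mono_neg) auto
  finally have "1 - exp (- 2 * \<eta> * T) \<le> norm (1 - exp (- z * of_real T))"
    using norm_triangle_ineq2[of 1 "exp (- z * of_real T)"]
    unfolding norm_one mult_1_right by linarith
  then have "(1 - exp (- 2 * \<eta> * T)) / (2 * (\<eta> + \<bar>\<beta>\<bar>) * ?m\<^sup>2)
      \<le> norm (1 - exp (- z * of_real T)) / norm z"
    using z_le z0 by (intro frac_le) auto
  moreover have "?m powr (-2) = 1 / ?m\<^sup>2" using m1 by (simp add: powr_minus_divide)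
  ultimately show ?thesis by (simp add: eq)
qed

text \<open>For the two-mode data the upper bound \<open>O(m\<^bsup>2s\<^esup>)\<close> and the lower bound of order \<open>m\<^bsup>-2\<^esup>\<close> for the same
coefficient give \<open>c0 = O(m\<^bsup>2s + 2\<^esup>)\<close>, and the exponent is negative.\<close>

lemma flow_map_not_C2:
  assumes flow: "is_flow_map \<beta> \<eta> s T \<Phi>" and s: "s < -1"
  shows "\<not> C2_map (sobolev s) (sobolev_norm s) (sobolev s) (sobolev_norm s) (\<Phi> T)"
proof
  assume C2: "C2_map (sobolev s) (sobolev_norm s) (sobolev s) (sobolev_norm s) (\<Phi> T)"
  have s0: "s \<le> 0" using s by simp
  obtain K where K: "\<And>\<phi> a b \<rho> C. \<phi> \<in> sobolev s \<Longrightarrow> 0 < \<rho> \<Longrightarrow>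
      (\<And>r. \<bar>r\<bar> < \<rho> \<Longrightarrow>
        norm (fourier_coeff (\<Phi> T (r *\<^sub>R \<phi>)) 1 - (of_real r * a - of_real (r\<^sup>2) * b)) \<le> C * \<bar>r\<bar> ^ 3) \<Longrightarrow>
      norm b \<le> K * (sobolev_norm s \<phi>)\<^sup>2"
    by (rule C2_map_second_coeff_bounded[OF C2, of 1]) blast
  define c0 where "c0 = (1 - exp (- 2 * \<eta> * T)) / (2 * (\<eta> + \<bar>\<beta>\<bar>))"
  have c0: "0 < c0" unfolding c0_def using eta_pos T_pos by (intro divide_pos_pos) auto
  have bound: "c0 \<le> \<bar>K\<bar> * 4 * pi * real n powr (2 * s + 2)" if n: "1 \<le> n" for n :: nat
  proof -
    let ?m = "int n"
    have dec: "norm (two_modes ?m k) \<le> weight (?m + 1) / weight k" for k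
      by (rule two_modes_decay) simp
    have mem: "fourier_synth (two_modes ?m) \<in> sobolev s"
      by (rule sobolev_of_decay[OF s0, of _ "weight (?m + 1)"])
         (simp add: fourier_coeff_synth_of_decay[OF dec] dec)
    obtain \<rho> C where "0 < \<rho>" "\<And>r. \<bar>r\<bar> < \<rho> \<Longrightarrow> norm (fourier_coeff (\<Phi> T (r *\<^sub>R fourier_synth (two_modes ?m))) 1
        - (of_real r * (propagator 1 T * two_modes ?m 1)
           - of_real (r\<^sup>2) * duhamel_coeff (free_evolution (two_modes ?m)) (free_evolution (two_modes ?m)) T 1)) \<le> C * \<bar>r\<bar> ^ 3"
      using flow_map_expansion[OF flow s0 dec] by metis
    from K[OF mem this]
    have "norm (duhamel_coeff (free_evolution (two_modes ?m)) (free_evolution (two_modes ?m)) T 1)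
        \<le> K * (sobolev_norm s (fourier_synth (two_modes ?m)))\<^sup>2" .
    also have "\<dots> \<le> \<bar>K\<bar> * (4 * pi * of_int ?m powr (2 * s))"
      using n by (intro mult_mono sobolev_norm_two_modes s0) auto
    finally have "c0 * real n powr (-2) \<le> \<bar>K\<bar> * (4 * pi * real n powr (2 * s))"
      using duhamel_two_modes_lower[of ?m] n by (simp add: c0_def)
    then have "(c0 * real n powr (-2)) * real n powr 2 \<le> (\<bar>K\<bar> * (4 * pi * real n powr (2 * s))) * real n powr 2"
      by (rule mult_right_mono) simp
    moreover have "real n powr (-2) * real n powr 2 = 1"
      using n by (subst powr_add[symmetric]) simp
    ultimately show ?thesis by (simp only: mult.assoc powr_add[symmetric] mult_1_right)
  qed
  have "(\<lambda>n. \<bar>K\<bar> * 4 * pi * real n powr (2 * s + 2)) \<longlonglongrightarrow> \<bar>K\<bar> * 4 * pi * 0"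
    using s by (intro tendsto_mult tendsto_const tendsto_neg_powr filterlim_real_sequentially) simp
  then have "c0 \<le> \<bar>K\<bar> * 4 * pi * 0"
    by (rule LIMSEQ_le_const) (use bound in blast)
  then show False using c0 by simp
qed

end

theorem theorem1p4:
  fixes \<beta> \<eta> s :: real
  assumes "\<beta> > 0" and "\<eta> > 0" and "s < -1"
  shows "\<not> (\<exists>T>0. \<exists>\<Phi>. is_flow_map \<beta> \<eta> s T \<Phi> \<and>
           (\<forall>t\<in>{0..T}. C2_map (sobolev s) (sobolev_norm s) (sobolev s) (sobolev_norm s) (\<Phi> t)))"
proof clarify
  fix T :: real and \<Phi>
  assume "0 < T" and flow: "is_flow_map \<beta> \<eta> s T \<Phi>"
    and C2: "\<forall>t\<in>{0..T}. C2_map (sobolev s) (sobolev_norm s) (sobolev s) (sobolev_norm s) (\<Phi> t)"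
  then interpret chen_lee \<beta> \<eta> T using assms by unfold_locales
  show False using flow_map_not_C2[OF flow \<open>s < -1\<close>] C2 \<open>0 < T\<close> by simp
qed

end
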